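(* Let $h:[0,1]\to(0,\infty)$ and $f:[0,\infty)\to[0,\infty)$ be continuously differentiable, suppose there is $t_0\ge0$ with $f>0$ on $[t_0,\infty)$ and $f\in C^2([t_0,\infty))$, put $g=\log f$ on $[t_0,\infty)$, and assume condition (H1) of the context with $q>2$. Let $(\lambda_n,\mu_n,u_n)\in(0,\infty)\times(0,\infty)\times C^2([0,1])$ satisfy $-u_n''-\frac1r u_n'=\lambda_n h(r)f(u_n)$, $u_n>0$ in $(0,1)$, $u_n(0)=\mu_n$, $u_n'(0)=0=u_n(1)$, with $\mu_n\to\infty$. Then $$\lim_{n\to\infty} g'(\mu_n)\int_0^1\lambda_n h f(u_n)\,r\,dr=4=\lim_{n\to\infty}\int_0^1\lambda_n h f'(u_n)\,r\,dr,$$ $$g'(\mu_n)u_n(r)\to 4\log\frac1r\ \text{ in } C^2_{\mathrm{loc}}((0,1]),$$ and $$\lim_{n\to\infty}\frac{\log\frac1{\lambda_n}}{g(\mu_n)}=\frac{2-p}{2}.$$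
   Context: Condition (H1): (i) $g'(t)>0$ and $g''(t)>0$ for all $t\ge t_0$, and there is a pair $(q,p)$ with either $q=1$ and $p\in(0,\infty]$, or $q\in(1,\infty)$ and $p\in(0,\infty)$, such that $\lim_{t\to\infty}\frac{g'(t)^2}{g(t)g''(t)}=q$ and $\lim_{t\to\infty}\frac{tg'(t)}{g(t)}=p$; (ii) if $q=1$, then $tg'(t)/g(t)$ is nondecreasing on $[t_0,\infty)$ and there exist $k\in\mathbb{N}$, $\hat g\in C^2([t_0,\infty))$ with $f=\exp_k\circ\hat g$ and $\hat g'/\hat g$ nonincreasing. In integrals $h=h(r)$, $f(u_n)=f(u_n(r))$. *)

theory Defs
  imports "HOL-Analysis.Analysis"
begin

text \<open>Condition (H1) for g = log f on [t0,oo), with g' and g'' the first and second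
  derivatives of g on [t0,oo) (one-sided at t0). The exponent p lives in (0,oo],
  hence is an extended real.\<close>
definition H1 :: "(real \<Rightarrow> real) \<Rightarrow> (real \<Rightarrow> real) \<Rightarrow> (real \<Rightarrow> real) \<Rightarrow> (real \<Rightarrow> real)
                   \<Rightarrow> real \<Rightarrow> real \<Rightarrow> ereal \<Rightarrow> bool" where
  "H1 f g g' g'' t0 q p \<longleftrightarrow>
     (\<forall>t\<ge>t0. g' t > 0 \<and> g'' t > 0) \<and>
     ((q = 1 \<and> 0 < p) \<or> (1 < q \<and> 0 < p \<and> p < \<infinity>)) \<and>
     ((\<lambda>t. (g' t)\<^sup>2 / (g t * g'' t)) \<longlongrightarrow> q) at_top \<and>
     ((\<lambda>t. ereal (t * g' t / g t)) \<longlongrightarrow> p) at_top \<and>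
     (q = 1 \<longrightarrow>
        mono_on {t0..} (\<lambda>t. t * g' t / g t) \<and>
        (\<exists>k::nat. k \<ge> 1 \<and> (\<exists>gh gh' gh''.
            (\<forall>t\<ge>t0. (gh has_real_derivative gh' t) (at t within {t0..})) \<and>
            (\<forall>t\<ge>t0. (gh' has_real_derivative gh'' t) (at t within {t0..})) \<and>
            continuous_on {t0..} gh'' \<and>
            (\<forall>t\<ge>t0. f t = (exp ^^ k) (gh t)) \<and>
            antimono_on {t0..} (\<lambda>t. gh' t / gh t))))"

end

theory Submission
  imports Defs "HOL-Real_Asymp.Real_Asymp"
begin

text \<open>
  Put \<open>a r = - g'(\<mu>) r u'(r)\<close> (the rescaled mass of the disc of radius \<open>r\<close>) and
  \<open>b r = g'(\<mu>) \<lambda> h r\<^sup>2 f(u)\<close>. With respect to \<open>ln r\<close> the equation reads \<open>a' = b\<close> and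
  \<open>b' = b (2 - (g'(u)/g'(\<mu>)) a + r h'/h)\<close>, a perturbation of the Liouville system \<open>a' = b\<close>,
  \<open>b' = b (2 - a)\<close>, for which \<open>b = 2 a - a\<^sup>2/2\<close> and \<open>a\<close> rises from \<open>0\<close> to \<open>4\<close>. Since \<open>g'\<close> is increasing,
  \<open>a\<close> reaches \<open>4 - \<epsilon>\<close> at a radius tending to \<open>0\<close>, where \<open>\<mu> - u = O(1/g'(\<mu>))\<close> and \<open>b = O(\<epsilon>)\<close>.
  From there on \<open>u\<close> falls with slope at least \<open>(4 - \<epsilon>)/g'(\<mu>)\<close> in \<open>ln r\<close>, so \<open>ln b\<close> changes by at most
  \<open>g(u) - g(\<mu>) + g'(\<mu>) (\<mu> - u)/(2 - \<epsilon>/2) + O(1)\<close>. The assumption \<open>q > 2\<close> means \<open>p < 2\<close>; the chords of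
  the convex function \<open>g\<close> then have slope close to \<open>g'(\<mu>)/p > g'(\<mu>)/2\<close>, \<open>b\<close> decays exponentially in
  \<open>g'(\<mu>)(\<mu> - u)\<close>, and the tail carries mass \<open>O(\<epsilon>)\<close> only. Everything else is read off from \<open>a \<longrightarrow> 4\<close>.
\<close>

section \<open>The growth of the nonlinearity\<close>

text \<open>Every differential inequality below is integrated this way, by exhibiting an auxiliary
  function whose derivative has a sign. Derivatives are required in the open interval only, because
  at \<open>t0\<close>, \<open>0\<close> and \<open>1\<close> they are one-sided.\<close>

lemma deriv_nonneg_imp_le:
  fixes F F' :: "real \<Rightarrow> real"
  assumes "a \<le> b" "continuous_on {a..b} F"
    and "\<And>x. a < x \<Longrightarrow> x < b \<Longrightarrow> (F has_real_derivative F' x) (at x)"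
    and "\<And>x. a < x \<Longrightarrow> x < b \<Longrightarrow> 0 \<le> F' x"
  shows "F a \<le> F b"
  using DERIV_nonneg_imp_increasing_open[of a b F] assms by blast

lemma deriv_nonpos_imp_ge:
  fixes F F' :: "real \<Rightarrow> real"
  assumes "a \<le> b" "continuous_on {a..b} F"
    and "\<And>x. a < x \<Longrightarrow> x < b \<Longrightarrow> (F has_real_derivative F' x) (at x)"
    and "\<And>x. a < x \<Longrightarrow> x < b \<Longrightarrow> F' x \<le> 0"
  shows "F b \<le> F a"
  using DERIV_nonpos_imp_decreasing_open[of a b F] assms by blast

text \<open>The name anticipates \<open>p_less_2\<close>: \<open>t g'/g\<close> tends to
  \<open>p\<close>, so \<open>g\<close> grows roughly like the power \<open>p\<close> of
  \<open>t\<close>, and \<open>q > 2\<close> forces \<open>p < 2\<close>.\<close>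

locale subquadratic_growth =
  fixes g g' g'' :: "real \<Rightarrow> real" and t0 q p :: real
  assumes g_d1: "t0 \<le> t \<Longrightarrow> (g has_real_derivative g' t) (at t within {t0..})"
    and g_d2: "t0 \<le> t \<Longrightarrow> (g' has_real_derivative g'' t) (at t within {t0..})"
    and g'_pos: "t0 \<le> t \<Longrightarrow> 0 < g' t"
    and g''_pos: "t0 \<le> t \<Longrightarrow> 0 < g'' t"
    and q_gt: "2 < q" and p_pos: "0 < p" and t0_nonneg: "0 \<le> t0"
    and lim_q: "((\<lambda>t. (g' t)\<^sup>2 / (g t * g'' t)) \<longlongrightarrow> q) at_top"
    and lim_p: "((\<lambda>t. t * g' t / g t) \<longlongrightarrow> p) at_top"
begin

section \<open>Convexity of \<open>g\<close>\<close>

lemma g_deriv: "t0 < t \<Longrightarrow> (g has_real_derivative g' t) (at t)"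
  and g'_deriv: "t0 < t \<Longrightarrow> (g' has_real_derivative g'' t) (at t)"
  using g_d1[of t] g_d2[of t] at_within_interior[of t "{t0..}"] by auto

lemma g_cont: "t0 \<le> s \<Longrightarrow> continuous_on {s..t} g"
  by (rule DERIV_continuous_on[where D = g']) (auto intro!: DERIV_subset[OF g_d1])

lemma g'_cont: "t0 \<le> s \<Longrightarrow> continuous_on {s..t} g'"
  by (rule DERIV_continuous_on[where D = g'']) (auto intro!: DERIV_subset[OF g_d2])

lemma g'_mono:
  assumes "t0 \<le> s" "s \<le> t" shows "g' s \<le> g' t"
  by (rule deriv_nonneg_imp_le[where F' = g''])
    (use assms g'_cont g'_deriv g''_pos in \<open>auto intro: less_imp_le\<close>)

lemma chord_lower:
  assumes "t0 \<le> s" "s \<le> t" shows "g' s * (t - s) \<le> g t - g s"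
proof -
  have "g s - g' s * s \<le> g t - g' s * t"
    by (rule deriv_nonneg_imp_le[where F = "\<lambda>x. g x - g' s * x" and F' = "\<lambda>x. g' x - g' s"])
      (use assms g'_mono in \<open>auto intro!: continuous_intros g_cont derivative_eq_intros g_deriv\<close>)
  then show ?thesis by (simp add: algebra_simps)
qed

lemma chord_upper:
  assumes "t0 \<le> s" "s \<le> t" shows "g t - g s \<le> g' t * (t - s)"
proof -
  have "g t - g' t * t \<le> g s - g' t * s"
    by (rule deriv_nonpos_imp_ge[where F = "\<lambda>x. g x - g' t * x" and F' = "\<lambda>x. g' x - g' t"])
      (use assms g'_mono in \<open>auto intro!: continuous_intros g_cont derivative_eq_intros g_deriv\<close>)
  then show ?thesis by (simp add: algebra_simps)
qed

lemma g_mono: "t0 \<le> s \<Longrightarrow> s \<le> t \<Longrightarrow> g s \<le> g t"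
  using chord_lower[of s t] g'_pos[of s] mult_nonneg_nonneg[of "g' s" "t - s"] by linarith

text \<open>By convexity, the chord of \<open>g\<close> ending at \<open>t\<close> gets steeper as
  its left end moves from \<open>t0\<close> to \<open>s\<close>: both \<open>[t0, s]\<close> and
  \<open>[s, t]\<close> are compared with the tangent at \<open>s\<close>. The cross-multiplied form
  includes the degenerate cases \<open>s = t0\<close> and \<open>s = t\<close>.\<close>

lemma chord_slope:
  assumes "t0 \<le> s" "s \<le> t"
  shows "(g t - g t0) * (t - s) \<le> (g t - g s) * (t - t0)"
proof -
  have "(g s - g t0) * (t - s) \<le> g' s * (s - t0) * (t - s)"
    using chord_upper[of t0 s] assms by (intro mult_right_mono) auto
  also have "\<dots> = g' s * (t - s) * (s - t0)" by simp
  also have "\<dots> \<le> (g t - g s) * (s - t0)"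
    using chord_lower[of s t] assms by (intro mult_right_mono) auto
  finally show ?thesis by (simp add: algebra_simps)
qed

section \<open>Behaviour of \<open>g\<close> and \<open>g'\<close> at infinity\<close>

lemma g_at_top: "filterlim g at_top at_top"
proof (rule filterlim_at_top_mono)
  show "filterlim (\<lambda>t. g t0 + g' t0 * (t - t0)) at_top at_top"
    using g'_pos[of t0] by real_asymp
  show "\<forall>\<^sub>F t in at_top. g t0 + g' t0 * (t - t0) \<le> g t"
    using eventually_ge_at_top[of t0] by eventually_elim (use chord_lower[of t0] in force)
qed

lemma g_pos_ev: "\<forall>\<^sub>F t in at_top. 0 < g t"
  using g_at_top by (simp add: filterlim_at_top_dense)

lemma curvature_bounds:
  assumes "l < q" "q < r"
  shows "\<forall>\<^sub>F t in at_top. l * (g t * g'' t) < (g' t)\<^sup>2 \<and> (g' t)\<^sup>2 < r * (g t * g'' t)"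
  using order_tendstoD(1)[OF lim_q assms(1)] order_tendstoD(2)[OF lim_q assms(2)]
    g_pos_ev eventually_ge_at_top[of t0]
proof eventually_elim
  case (elim t)
  then have "0 < g t * g'' t" using g''_pos by simp
  with elim show ?case by (simp add: field_simps)
qed

text \<open>The bound \<open>g'^2 < 2 q g g''\<close> says that \<open>ln g' - ln g / (2 q)\<close>
  is increasing, so \<open>g'\<close> dominates a constant multiple of \<open>g\<close> to the power
  \<open>1/(2q)\<close>. Any number above \<open>q\<close> could replace \<open>2 q\<close>.\<close>

lemma g'_at_top: "filterlim g' at_top at_top"
proof -
  have "1 < q" "q < 2 * q" using q_gt by auto
  have "\<forall>\<^sub>F t in at_top. t0 < t \<and> 0 < g t \<and> (g' t)\<^sup>2 < (2 * q) * (g t * g'' t)"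
    using curvature_bounds[OF \<open>1 < q\<close> \<open>q < 2 * q\<close>] g_pos_ev eventually_gt_at_top[of t0]
    by eventually_elim simp
  then obtain T where T: "\<And>t. T \<le> t \<Longrightarrow> t0 < t \<and> 0 < g t \<and> (g' t)\<^sup>2 < (2 * q) * (g t * g'' t)"
    by (auto simp: eventually_at_top_linorder)
  have T_ne: "t0 \<le> t \<and> g t \<noteq> 0 \<and> g' t \<noteq> 0" if "T \<le> t" for t
    using T[OF that] g'_pos[of t] by simp
  define L where "L = ln (g' T) - ln (g T) / (2 * q)"
  have le: "L \<le> ln (g' t) - ln (g t) / (2 * q)" if "T \<le> t" for t
    unfolding L_def
  proof (rule deriv_nonneg_imp_le[where F = "\<lambda>t. ln (g' t) - ln (g t) / (2 * q)"
        and F' = "\<lambda>t. g'' t / g' t - g' t / g t / (2 * q)"])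
    show "continuous_on {T..t} (\<lambda>t. ln (g' t) - ln (g t) / (2 * q))"
      using T_ne[of T] T_ne q_gt by (intro continuous_intros g_cont g'_cont) auto
    fix x assume x: "T < x" "x < t"
    have pos: "t0 < x" "0 < g x" "0 < g' x" and c: "(g' x)\<^sup>2 < (2 * q) * (g x * g'' x)"
      using T[of x] x g'_pos[of x] by auto
    show "((\<lambda>t. ln (g' t) - ln (g t) / (2 * q)) has_real_derivative
        g'' x / g' x - g' x / g x / (2 * q)) (at x)"
      using pos q_gt by (auto intro!: derivative_eq_intros g_deriv g'_deriv)
    show "0 \<le> g'' x / g' x - g' x / g x / (2 * q)"
      using pos c q_gt by (simp add: field_simps power2_eq_square)
  qed (use that in auto)
  have "filterlim (\<lambda>x::real. exp (L + ln x / (2 * q))) at_top at_top"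
    using q_gt by real_asymp
  then have "filterlim (\<lambda>t. exp (L + ln (g t) / (2 * q))) at_top at_top"
    using g_at_top by (rule filterlim_compose)
  moreover have "\<forall>\<^sub>F t in at_top. exp (L + ln (g t) / (2 * q)) \<le> g' t"
    using eventually_ge_at_top[of T]
  proof eventually_elim
    case (elim t)
    have "exp (L + ln (g t) / (2 * q)) \<le> exp (ln (g' t))" using le[OF elim] by simp
    also have "\<dots> = g' t" using T[OF elim] g'_pos[of t] by simp
    finally show ?case .
  qed
  ultimately show ?thesis by (rule filterlim_at_top_mono)
qed

text \<open>Since \<open>(g/g')' = 1 - g g''/g'\<^sup>2 \<longrightarrow> 1 - 1/q > 1/2\<close>, the quotient \<open>g/(t g')\<close> has a limit above
  \<open>1/2\<close>.\<close>
lemma p_less_2: "p < 2"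
proof -
  \<comment> \<open>A number strictly between \<open>2\<close> and \<open>q\<close>: then
    \<open>(g/g')' >= 1 - 1/l = k\<close> with \<open>k > 1/2\<close>, and this strict gap survives
    the passage to the limit.\<close>
  define l where "l = (q + 2) / 2"
  have l: "2 < l" "l < q" using q_gt by (auto simp: l_def)
  have "\<forall>\<^sub>F t in at_top. t0 < t \<and> 0 < g t \<and> l * (g t * g'' t) < (g' t)\<^sup>2"
    using curvature_bounds[OF l(2) less_add_one] g_pos_ev eventually_gt_at_top[of t0]
    by eventually_elim simp
  then obtain T where T: "\<And>t. T \<le> t \<Longrightarrow> t0 < t \<and> 0 < g t \<and> l * (g t * g'' t) < (g' t)\<^sup>2"
    by (auto simp: eventually_at_top_linorder)
  have T_ne: "t0 \<le> t \<and> g t \<noteq> 0 \<and> g' t \<noteq> 0" if "T \<le> t" for t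
    using T[OF that] g'_pos[of t] by simp
  define k where "k = 1 - 1 / l"
  have k: "1 / 2 < k" using l by (simp add: k_def field_simps)
  have le: "g T / g' T - k * T \<le> g t / g' t - k * t" if "T \<le> t" for t
  proof (rule deriv_nonneg_imp_le[where F = "\<lambda>t. g t / g' t - k * t"
        and F' = "\<lambda>t. (g' t * g' t - g t * g'' t) / (g' t * g' t) - k"])
    show "continuous_on {T..t} (\<lambda>t. g t / g' t - k * t)"
      using T_ne[of T] T_ne by (intro continuous_intros g_cont g'_cont) auto
    fix x assume x: "T < x" "x < t"
    have pos: "t0 < x" "0 < g x" "0 < g' x" and c: "l * (g x * g'' x) < (g' x)\<^sup>2"
      using T[of x] x g'_pos[of x] by auto
    show "((\<lambda>t. g t / g' t - k * t) has_real_derivative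
        (g' x * g' x - g x * g'' x) / (g' x * g' x) - k) (at x)"
      using pos by (auto intro!: derivative_eq_intros g_deriv g'_deriv)
    show "0 \<le> (g' x * g' x - g x * g'' x) / (g' x * g' x) - k"
      using pos c l by (simp add: k_def field_simps power2_eq_square)
  qed (use that in auto)
  have "((\<lambda>t. inverse (t * g' t / g t)) \<longlongrightarrow> inverse p) at_top"
    using lim_p p_pos by (intro tendsto_inverse) auto
  moreover have "((\<lambda>t. (g T / g' T - k * T) / t + k) \<longlongrightarrow> k) at_top" by real_asymp
  moreover have "\<forall>\<^sub>F t in at_top. (g T / g' T - k * T) / t + k \<le> inverse (t * g' t / g t)"
    using eventually_ge_at_top[of T] eventually_gt_at_top[of 0]
  proof eventually_elim
    case (elim t)
    have "((g T / g' T - k * T) + k * t) / t \<le> (g t / g' t) / t"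
      using le[of t] elim by (intro divide_right_mono) auto
    moreover have "g t / g' t / t = inverse (t * g' t / g t)"
      by (simp add: inverse_divide mult.commute)
    moreover have "((g T / g' T - k * T) + k * t) / t = (g T / g' T - k * T) / t + k"
      using elim by (simp add: add_divide_distrib)
    ultimately show ?case by (simp add: mult.commute)
  qed
  ultimately have "k \<le> inverse p"
    by (rule tendsto_le[OF trivial_limit_at_top_linorder])
  then have "1 / 2 < inverse p" using k by linarith
  then show ?thesis using p_pos by (simp add: field_simps)
qed

text \<open>Inside the bubble the solution drops by \<open>O(1/g'(mu))\<close>; this shows that
  \<open>g'\<close> hardly changes over such a distance. As \<open>q > 1\<close>, eventually
  \<open>g'' <= g'^2/g\<close>, so over length \<open>K/g' t\<close> the change of \<open>g'\<close>
  is at most \<open>K g' t/g s\<close>, a vanishing fraction of \<open>g' t\<close>.\<close>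

lemma g'_near:
  assumes "0 < K" "\<theta> < 1"
  shows "\<forall>\<^sub>F t in at_top. \<theta> * g' t \<le> g' (t - K / g' t)"
proof -
  have "\<forall>\<^sub>F t in at_top. 1 * (g t * g'' t) < (g' t)\<^sup>2 \<and> (g' t)\<^sup>2 < 2 * q * (g t * g'' t)"
    by (rule curvature_bounds) (use q_gt in auto)
  moreover have "\<forall>\<^sub>F t in at_top. K / (1 - \<theta>) \<le> g t \<and> 0 < g t"
    using g_at_top g_pos_ev by (simp add: filterlim_at_top eventually_conj_iff)
  ultimately have "\<forall>\<^sub>F t in at_top. t0 < t \<and> K / (1 - \<theta>) \<le> g t \<and> 0 < g t \<and> g t * g'' t \<le> (g' t)\<^sup>2"
    using eventually_gt_at_top[of t0] by eventually_elim simp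
  then obtain T where T: "\<And>t. T \<le> t \<Longrightarrow>
      t0 < t \<and> K / (1 - \<theta>) \<le> g t \<and> 0 < g t \<and> g t * g'' t \<le> (g' t)\<^sup>2"
    by (auto simp: eventually_at_top_linorder)
  have "\<forall>\<^sub>F t in at_top. 1 \<le> g' t" using g'_at_top by (simp add: filterlim_at_top)
  \<comment> \<open>Since \<open>1 <= g' t\<close>, the left end \<open>t - K / g' t\<close> is
    still at least \<open>T\<close>.\<close>
  then show ?thesis using eventually_ge_at_top[of "T + K"]
  proof eventually_elim
    case (elim t)
    define s where "s = t - K / g' t"
    have "K / g' t \<le> K" using elim assms by (simp add: divide_le_eq_1 field_simps)
    then have s: "T \<le> s" "s \<le> t" using elim assms by (auto simp: s_def)
    have ts: "t0 < t" "t0 < s" "0 < g s" "K / (1 - \<theta>) \<le> g s" using T[of t] T[of s] s by auto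
    \<comment> \<open>An upper bound for \<open>g''\<close> on the interval from \<open>s\<close> to
      \<open>t\<close>, as \<open>g\<close> is smallest at \<open>s\<close> and \<open>g'\<close>
      largest at \<open>t\<close>.\<close>
    define M where "M = (g' t)\<^sup>2 / g s"
    have "g' t - M * t \<le> g' s - M * s"
    proof (rule deriv_nonpos_imp_ge[where F = "\<lambda>x. g' x - M * x" and F' = "\<lambda>x. g'' x - M"])
      show "continuous_on {s..t} (\<lambda>x. g' x - M * x)"
        using ts by (intro continuous_intros g'_cont) auto
      fix x assume x: "s < x" "x < t"
      show "((\<lambda>x. g' x - M * x) has_real_derivative g'' x - M) (at x)"
        using x ts by (auto intro!: derivative_eq_intros g'_deriv)
      have "g s * g'' x \<le> g x * g'' x"
        using g_mono[of s x] g''_pos[of x] x ts by (intro mult_right_mono) auto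
      also have "\<dots> \<le> (g' x)\<^sup>2" using T[of x] x s by auto
      also have "\<dots> \<le> (g' t)\<^sup>2" using g'_mono[of x t] g'_pos[of x] x ts by (intro power_mono) auto
      finally show "g'' x - M \<le> 0" using ts by (simp add: M_def field_simps)
    qed (use s in auto)
    moreover have "M * t - M * s = g' t * (K / g s)"
    proof -
      have "M * t - M * s = M * (K / g' t)" by (simp add: s_def flip: right_diff_distrib)
      then show ?thesis using elim by (simp add: M_def power2_eq_square)
    qed
    moreover have "K / g s \<le> 1 - \<theta>"
      using ts assms by (simp add: field_simps)
    then have "g' t * (K / g s) \<le> g' t * (1 - \<theta>)"
      using elim by (intro mult_left_mono) auto
    ultimately show ?case unfolding s_def by (simp add: algebra_simps)
  qed
qed

text \<open>Because \<open>t g'/g\<close> stays below \<open>p + 1\<close>, the quotient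
  \<open>g'/g\<close> is \<open>O(1/t)\<close>.\<close>

lemma g'_le_g: "\<forall>\<^sub>F t in at_top. g' t \<le> g t"
proof -
  have "\<forall>\<^sub>F t in at_top. t * g' t / g t < p + 1"
    by (rule order_tendstoD(2)[OF lim_p]) simp
  then show ?thesis using g_pos_ev eventually_ge_at_top[of "p + 1"] eventually_gt_at_top[of t0]
  proof eventually_elim
    case (elim t)
    have "(p + 1) * g' t \<le> t * g' t" using elim g'_pos[of t] by (intro mult_right_mono) auto
    also have "\<dots> \<le> (p + 1) * g t" using elim by (simp add: divide_less_eq)
    finally show ?case using p_pos by simp
  qed
qed

text \<open>This makes the term \<open>ln (g' mu)\<close> in \<open>ln_lam_eq\<close> negligible
  against \<open>g mu\<close>.\<close>

lemma lim_ln_g': "((\<lambda>t. ln (g' t) / g t) \<longlongrightarrow> 0) at_top"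
proof (rule tendsto_sandwich[where f = "\<lambda>_. 0" and h = "\<lambda>t. ln (g t) / g t"])
  have ge1: "\<forall>\<^sub>F t in at_top. 1 \<le> g' t" using g'_at_top by (simp add: filterlim_at_top)
  show "\<forall>\<^sub>F t in at_top. 0 \<le> ln (g' t) / g t"
    using ge1 g_pos_ev by eventually_elim simp
  show "\<forall>\<^sub>F t in at_top. ln (g' t) / g t \<le> ln (g t) / g t"
    using ge1 g_pos_ev g'_le_g by eventually_elim (simp add: divide_right_mono)
  have "((\<lambda>x::real. ln x / x) \<longlongrightarrow> 0) at_top" by real_asymp
  then show "((\<lambda>t. ln (g t) / g t) \<longlongrightarrow> 0) at_top"
    using g_at_top by (rule filterlim_compose)
qed simp

lemma lim_const_over_g: "((\<lambda>t. c / g t) \<longlongrightarrow> 0) at_top"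
  using g_at_top by (intro tendsto_divide_0[OF tendsto_const] filterlim_at_top_imp_at_infinity)

end

section \<open>A single solution\<close>

text \<open>The one constant \<open>C\<close> gathers all bounds that depend on \<open>h\<close> and
  \<open>f\<close> alone, including the lower bound of \<open>h\<close> and the behaviour of
  \<open>f\<close> below \<open>t0\<close>, so that the estimates are uniform along a sequence of
  solutions.\<close>

locale radial_solution = subquadratic_growth +
  fixes h h' f f' u u' u'' :: "real \<Rightarrow> real" and C lam mu :: real
  assumes h_d1: "r \<in> {0..1} \<Longrightarrow> (h has_real_derivative h' r) (at r within {0..1})"
    and h'_bound: "r \<in> {0..1} \<Longrightarrow> \<bar>h' r\<bar> \<le> C * h r"
    and h_upper: "r \<in> {0..1} \<Longrightarrow> h r \<le> C"
    and h_lower: "r \<in> {0..1} \<Longrightarrow> 1 \<le> C * h r"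
    and C_ge_1: "1 \<le> C"
    and f_d1: "0 \<le> t \<Longrightarrow> (f has_real_derivative f' t) (at t within {0..})"
    and f'_cont: "continuous_on {0..} f'"
    and f_nonneg: "0 \<le> t \<Longrightarrow> 0 \<le> f t"
    and f_exp: "t0 \<le> t \<Longrightarrow> f t = exp (g t)"
    and f'_exp: "t0 \<le> t \<Longrightarrow> f' t = g' t * f t"
    and f_bound: "0 \<le> t \<Longrightarrow> t \<le> t0 \<Longrightarrow> f t \<le> C"
    and f'_bound: "0 \<le> t \<Longrightarrow> t \<le> t0 \<Longrightarrow> \<bar>f' t\<bar> \<le> C"
    and lam_pos: "0 < lam" and mu_gt: "t0 < mu"
    and u_d1: "r \<in> {0..1} \<Longrightarrow> (u has_real_derivative u' r) (at r within {0..1})"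
    and u_d2: "r \<in> {0..1} \<Longrightarrow> (u' has_real_derivative u'' r) (at r within {0..1})"
    and u''_cont: "continuous_on {0..1} u''"
    and u_eq: "r \<in> {0<..<1} \<Longrightarrow> - u'' r - u' r / r = lam * h r * f (u r)"
    and u_nonneg: "r \<in> {0..1} \<Longrightarrow> 0 \<le> u r"
    and u_0: "u 0 = mu" and u_1: "u 1 = 0"
begin

section \<open>The perturbed Liouville system for \<open>a\<close> and \<open>b\<close>\<close>

definition a :: "real \<Rightarrow> real" where "a r = - g' mu * r * u' r"

definition b :: "real \<Rightarrow> real" where "b r = g' mu * lam * h r * r\<^sup>2 * f (u r)"

lemma G_pos: "0 < g' mu"
  using g'_pos mu_gt by simp

lemma h_pos: "r \<in> {0..1} \<Longrightarrow> 0 < h r"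
  using h_lower[of r] C_ge_1 by (metis linorder_not_le mult_nonneg_nonpos not_one_le_zero order_trans zero_le_one)

lemma interior_01: "0 < r \<Longrightarrow> r < 1 \<Longrightarrow> at r within {0..1} = at (r::real)"
  using at_within_interior[of r "{0..1}"] by simp

lemma h_deriv: "0 < r \<Longrightarrow> r < 1 \<Longrightarrow> (h has_real_derivative h' r) (at r)"
  and u_deriv: "0 < r \<Longrightarrow> r < 1 \<Longrightarrow> (u has_real_derivative u' r) (at r)"
  and u'_deriv: "0 < r \<Longrightarrow> r < 1 \<Longrightarrow> (u' has_real_derivative u'' r) (at r)"
  using h_d1[of r] u_d1[of r] u_d2[of r] interior_01[of r] by auto

lemma h_cont: "continuous_on {0..1} h"
  and u_cont: "continuous_on {0..1} u"
  and u'_cont: "continuous_on {0..1} u'"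
  by (rule DERIV_continuous_on, erule h_d1 u_d1 u_d2)+

lemma f_cont: "continuous_on {0..} f"
  by (rule DERIV_continuous_on[OF f_d1]) simp

lemma fu_cont: "continuous_on {0..1} (\<lambda>r. f (u r))"
  by (rule continuous_on_compose2[OF f_cont u_cont]) (use u_nonneg in auto)

lemma a_cont: "continuous_on {0..1} a"
  unfolding a_def by (intro continuous_intros u'_cont)

lemma b_cont: "continuous_on {0..1} b"
  unfolding b_def by (intro continuous_intros h_cont fu_cont)

lemma b_nonneg: "r \<in> {0..1} \<Longrightarrow> 0 \<le> b r"
  unfolding b_def using G_pos lam_pos h_pos[of r] f_nonneg[OF u_nonneg[of r]] by simp

text \<open>The equation in divergence form, \<open>(r u')' = - lam h r f(u)\<close>; dividing by
  \<open>r\<close> turns the derivative in \<open>ln r\<close> into one in \<open>r\<close>.\<close>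

lemma a_deriv:
  assumes "0 < r" "r < 1" shows "(a has_real_derivative b r / r) (at r)"
proof -
  have "(a has_real_derivative (- g' mu * u' r - g' mu * r * u'' r)) (at r)"
    unfolding a_def using assms by (auto intro!: derivative_eq_intros u'_deriv)
  moreover have "b r / r = g' mu * r * (lam * h r * f (u r))"
    using assms by (simp add: b_def power2_eq_square)
  moreover have "lam * h r * f (u r) = - u'' r - u' r / r"
    using u_eq[of r] assms by simp
  moreover have "g' mu * r * (- u'' r - u' r / r) = - g' mu * u' r - g' mu * r * u'' r"
    using assms by (simp add: field_simps)
  ultimately show ?thesis by metis
qed

lemma a_0: "a 0 = 0" by (simp add: a_def)

lemma a_mono: "0 \<le> r \<Longrightarrow> r \<le> s \<Longrightarrow> s \<le> 1 \<Longrightarrow> a r \<le> a s"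
  by (rule deriv_nonneg_imp_le[where F = a and F' = "\<lambda>r. b r / r"])
    (auto intro!: continuous_on_subset[OF a_cont] a_deriv divide_nonneg_pos b_nonneg)

lemma a_nonneg: "r \<in> {0..1} \<Longrightarrow> 0 \<le> a r"
  using a_mono[of 0 r] a_0 by simp

lemma u'_eq: "0 < r \<Longrightarrow> u' r = - a r / (g' mu * r)"
  using G_pos by (simp add: a_def)

lemma u_antimono:
  assumes "0 \<le> r" "r \<le> s" "s \<le> 1" shows "u s \<le> u r"
proof (rule deriv_nonpos_imp_ge[where F = u and F' = u'])
  show "u' x \<le> 0" if "r < x" "x < s" for x
    using that assms a_nonneg[of x] G_pos by (simp add: u'_eq)
qed (use assms in \<open>auto intro!: continuous_on_subset[OF u_cont] u_deriv\<close>)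

text \<open>Logarithmic differentiation in \<open>ln r\<close>: the factors \<open>r^2\<close>,
  \<open>h\<close> and \<open>f(u)\<close> of \<open>b\<close> contribute \<open>2\<close>,
  \<open>r h'/h\<close> and \<open>g'(u) r u' = - g'(u) a / g' mu\<close>. The last one needs
  \<open>t0 <= u r\<close>, where \<open>f' = g' f\<close>.\<close>

lemma b_deriv:
  assumes r: "0 < r" "r < 1" and ur: "t0 \<le> u r"
  shows "(b has_real_derivative (b r / r) * (2 + r * h' r / h r - g' (u r) * a r / g' mu)) (at r)"
proof -
  have "u r \<in> {0..}" "0 < h r" using u_nonneg[of r] h_pos[of r] r by auto
  have "((f \<circ> u) has_real_derivative f' (u r) * u' r) (at r within {0..1})"
    by (rule DERIV_image_chain[OF DERIV_subset[OF f_d1] u_d1])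
      (use r u_nonneg in auto)
  then have fu: "((\<lambda>r. f (u r)) has_real_derivative f' (u r) * u' r) (at r)"
    using interior_01[OF r] by (simp add: o_def)
  have "(b has_real_derivative g' mu * lam * (h' r * r\<^sup>2 * f (u r) + h r * (2 * r) * f (u r)
      + h r * r\<^sup>2 * (f' (u r) * u' r))) (at r)"
    unfolding b_def
    by (rule derivative_eq_intros fu h_deriv[OF r] refl)+ (simp add: algebra_simps)
  moreover have "g' mu * lam * (h' r * r\<^sup>2 * f (u r) + h r * (2 * r) * f (u r)
      + h r * r\<^sup>2 * (f' (u r) * u' r)) =
      (b r / r) * (2 + r * h' r / h r - g' (u r) * a r / g' mu)"
    using r \<open>0 < h r\<close> G_pos f'_exp[OF ur]
    by (simp add: b_def a_def field_simps power2_eq_square)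
  ultimately show ?thesis by simp
qed

text \<open>For the Liouville equation both bounds become the relation \<open>b = 2 a - a\<^sup>2 / 2\<close>.\<close>

lemma b_lower:
  assumes "0 \<le> r" "r < 1" "t0 \<le> u r"
  shows "a r * (2 - C * r - a r / 2) \<le> b r"
proof -
  have "b 0 - (2 - C * r) * a 0 + (a 0)\<^sup>2 / 2 \<le> b r - (2 - C * r) * a r + (a r)\<^sup>2 / 2"
  \<comment> \<open>With \<open>C r\<close> dropped, this function would be the first integral of
    the Liouville system. It increases here because \<open>s h'/h >= - C r\<close> and
    \<open>g'(u s) <= g' mu\<close>; the coefficient is frozen at the outer radius
    \<open>r\<close>.\<close>
  proof (rule deriv_nonneg_imp_le[where F = "\<lambda>s. b s - (2 - C * r) * a s + (a s)\<^sup>2 / 2"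
        and F' = "\<lambda>s. (b s / s) * (2 + s * h' s / h s - g' (u s) * a s / g' mu)
          - (2 - C * r) * (b s / s) + a s * (b s / s)"])
    show "continuous_on {0..r} (\<lambda>s. b s - (2 - C * r) * a s + (a s)\<^sup>2 / 2)"
      using assms by (intro continuous_intros continuous_on_subset[OF a_cont] continuous_on_subset[OF b_cont]) auto
    fix s assume s: "0 < s" "s < r"
    have us: "t0 \<le> u s" using u_antimono[of s r] assms s by simp
    have b: "(b has_real_derivative (b s / s) * (2 + s * h' s / h s - g' (u s) * a s / g' mu)) (at s)"
      and a: "(a has_real_derivative b s / s) (at s)"
      using b_deriv a_deriv us s assms by auto
    show "((\<lambda>s. b s - (2 - C * r) * a s + (a s)\<^sup>2 / 2) has_real_derivative
        (b s / s) * (2 + s * h' s / h s - g' (u s) * a s / g' mu)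
          - (2 - C * r) * (b s / s) + a s * (b s / s)) (at s)"
      by (rule derivative_eq_intros a b refl | simp add: algebra_simps)+
    have hs: "0 < h s" "\<bar>h' s\<bar> \<le> C * h s" using h_pos h'_bound s assms by auto
    have "- h' s \<le> C * h s" using hs by linarith
    then have "- (s * h' s / h s) \<le> s * C" using hs s
      by (simp add: divide_simps mult.assoc) (metis mult_left_mono mult_minus_right less_imp_le)
    also have "\<dots> \<le> C * r" using s C_ge_1 by (simp add: mult.commute)
    finally have 1: "- (s * h' s / h s) \<le> C * r" .
    have "g' (u s) \<le> g' mu" using g'_mono[OF us] u_antimono[of 0 s] u_0 s assms by simp
    then have "g' (u s) * a s \<le> g' mu * a s"
      using a_nonneg[of s] s assms by (intro mult_right_mono) auto
    then have 2: "g' (u s) * a s / g' mu \<le> a s" using G_pos by (simp add: field_simps)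
    have "0 \<le> (b s / s) * (s * h' s / h s - g' (u s) * a s / g' mu + C * r + a s)"
      using 1 2 s assms b_nonneg[of s] by (intro mult_nonneg_nonneg) auto
    moreover have "k * (2 + x - y) - (2 - c) * k + z * k = k * (x - y + c + z)" for c k x y z :: real
      by (simp add: algebra_simps)
    ultimately show "0 \<le> (b s / s) * (2 + s * h' s / h s - g' (u s) * a s / g' mu)
          - (2 - C * r) * (b s / s) + a s * (b s / s)"
      by metis
  qed (use assms in auto)
  then show ?thesis by (simp add: a_0 b_def[of 0] algebra_simps power2_eq_square)
qed

lemma b_upper:
  assumes "0 \<le> r" "r < 1" "t0 \<le> u r" "\<theta> * g' mu \<le> g' (u r)"
  shows "b r \<le> a r * (2 + C * r - \<theta> * a r / 2)"
proof -
  have "b r - (2 + C * r) * a r + \<theta> * (a r)\<^sup>2 / 2 \<le> b 0 - (2 + C * r) * a 0 + \<theta> * (a 0)\<^sup>2 / 2"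
  proof (rule deriv_nonpos_imp_ge[where F = "\<lambda>s. b s - (2 + C * r) * a s + \<theta> * (a s)\<^sup>2 / 2"
        and F' = "\<lambda>s. (b s / s) * (2 + s * h' s / h s - g' (u s) * a s / g' mu)
          - (2 + C * r) * (b s / s) + \<theta> * a s * (b s / s)"])
    show "continuous_on {0..r} (\<lambda>s. b s - (2 + C * r) * a s + \<theta> * (a s)\<^sup>2 / 2)"
      using assms by (intro continuous_intros continuous_on_subset[OF a_cont] continuous_on_subset[OF b_cont]) auto
    fix s assume s: "0 < s" "s < r"
    have us: "u r \<le> u s" "t0 \<le> u s" using u_antimono[of s r] assms s by auto
    have b: "(b has_real_derivative (b s / s) * (2 + s * h' s / h s - g' (u s) * a s / g' mu)) (at s)"
      and a: "(a has_real_derivative b s / s) (at s)"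
      using b_deriv a_deriv us s assms by auto
    show "((\<lambda>s. b s - (2 + C * r) * a s + \<theta> * (a s)\<^sup>2 / 2) has_real_derivative
        (b s / s) * (2 + s * h' s / h s - g' (u s) * a s / g' mu)
          - (2 + C * r) * (b s / s) + \<theta> * a s * (b s / s)) (at s)"
      by (rule derivative_eq_intros a b refl | simp add: algebra_simps)+
    have hs: "0 < h s" "\<bar>h' s\<bar> \<le> C * h s" using h_pos h'_bound s assms by auto
    have "h' s \<le> C * h s" using hs by linarith
    then have "s * h' s / h s \<le> s * C" using hs s
      by (simp add: divide_simps mult.assoc)
    also have "\<dots> \<le> C * r" using s C_ge_1 by (simp add: mult.commute)
    finally have 1: "s * h' s / h s \<le> C * r" .
    \<comment> \<open>On the disc of radius \<open>r\<close> the value \<open>g'(u s)\<close> is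
      smallest at the boundary, so the hypothesis at \<open>r\<close> controls it everywhere
      inside.\<close>
    have "\<theta> * g' mu \<le> g' (u s)" using g'_mono[OF assms(3) us(1)] assms by simp
    then have "(\<theta> * g' mu) * a s \<le> g' (u s) * a s"
      using a_nonneg[of s] s assms by (intro mult_right_mono) auto
    then have 2: "\<theta> * a s \<le> g' (u s) * a s / g' mu" using G_pos by (simp add: field_simps)
    have "(b s / s) * (s * h' s / h s - g' (u s) * a s / g' mu - C * r + \<theta> * a s) \<le> 0"
      using 1 2 s assms b_nonneg[of s] by (intro mult_nonneg_nonpos) auto
    moreover have "k * (2 + x - y) - (2 + c) * k + z * k = k * (x - y - c + z)" for c k x y z :: real
      by (simp add: algebra_simps)
    ultimately show "(b s / s) * (2 + s * h' s / h s - g' (u s) * a s / g' mu)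
          - (2 + C * r) * (b s / s) + \<theta> * a s * (b s / s) \<le> 0"
      by metis
  qed (use assms in auto)
  then show ?thesis by (simp add: a_0 b_def[of 0] algebra_simps power2_eq_square)
qed

section \<open>The bubble: the mass reaches \<open>4 - \<epsilon>\<close> at a small radius\<close>

text \<open>While \<open>a <= 4 - \<epsilon>\<close> and \<open>C s <= \<epsilon>/4\<close>, the
  bracket in \<open>b_lower\<close> is at least \<open>\<epsilon>/4\<close>, hence
  \<open>a <= 4 b/\<epsilon>\<close>. As \<open>- u' = a/(g' mu s)\<close> and
  \<open>a' = b/s\<close>, the drop of \<open>u\<close> is paid for by the growth of
  \<open>a\<close>, which is at most \<open>4\<close>.\<close>

lemma height_drop:
  assumes r: "0 \<le> r" "r < 1" "t0 \<le> u r" and \<epsilon>: "0 < \<epsilon>" "C * r \<le> \<epsilon> / 4" "\<epsilon> \<le> 1"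
    and ar: "a r \<le> 4 - \<epsilon>"
  shows "mu - u r \<le> 16 / (\<epsilon> * g' mu)"
proof -
  have "a 0 / (\<epsilon> / 4 * g' mu) + u 0 \<le> a r / (\<epsilon> / 4 * g' mu) + u r"
  proof (rule deriv_nonneg_imp_le[where F = "\<lambda>s. a s / (\<epsilon> / 4 * g' mu) + u s"
        and F' = "\<lambda>s. (b s / s) / (\<epsilon> / 4 * g' mu) + u' s"])
    show "continuous_on {0..r} (\<lambda>s. a s / (\<epsilon> / 4 * g' mu) + u s)"
      using assms G_pos
      by (intro continuous_intros continuous_on_subset[OF a_cont] continuous_on_subset[OF u_cont]) auto
    fix s assume s: "0 < s" "s < r"
    show "((\<lambda>s. a s / (\<epsilon> / 4 * g' mu) + u s) has_real_derivative
        (b s / s) / (\<epsilon> / 4 * g' mu) + u' s) (at s)"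
      using s r by (intro DERIV_add DERIV_cdivide a_deriv u_deriv) auto
    have us: "t0 \<le> u s" using u_antimono[of s r] assms s by simp
    have as: "0 \<le> a s" "a s \<le> 4 - \<epsilon>" using a_nonneg[of s] a_mono[of s r] s r ar by auto
    have "C * s \<le> \<epsilon> / 4" using s C_ge_1 \<epsilon>
      by (smt (verit) mult_left_mono)
    then have "a s * (\<epsilon> / 4) \<le> a s * (2 - C * s - a s / 2)"
      using as \<epsilon> by (intro mult_left_mono) auto
    also have "\<dots> \<le> b s" using b_lower[of s] s r us by simp
    finally have "a s * (\<epsilon> / 4) \<le> b s" .
    then have "a s \<le> b s / (\<epsilon> / 4)" using \<epsilon> by (simp add: field_simps)
    then have "a s / (g' mu * s) \<le> b s / (\<epsilon> / 4) / (g' mu * s)"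
      using G_pos s by (intro divide_right_mono) auto
    then show "0 \<le> (b s / s) / (\<epsilon> / 4 * g' mu) + u' s"
      using s by (simp add: u'_eq mult.commute mult.left_commute)
  qed (use r in auto)
  then have "mu - u r \<le> a r / (\<epsilon> / 4 * g' mu)" by (simp add: a_0 u_0)
  also have "\<dots> \<le> 4 / (\<epsilon> / 4 * g' mu)" using ar \<epsilon> G_pos by (intro divide_right_mono) auto
  finally show ?thesis by simp
qed

lemma radius_level:
  assumes "0 \<le> c" "c \<le> mu" obtains r where "r \<in> {0..1}" "u r = c"
  using IVT2'[of u 1 c 0] u_cont u_0 u_1 assms by auto

text \<open>Suppose the mass stays below \<open>4 - \<epsilon>\<close> up to radius
  \<open>\<eta>\<close>. Then \<open>u \<eta>\<close> is still close to \<open>mu\<close>, while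
  \<open>b \<eta>\<close> is bounded, which bounds the source term and hence \<open>a\<close> on the
  rest of the disc; integrating \<open>u'\<close> up to the boundary value \<open>0\<close> bounds
  \<open>u \<eta>\<close> independently of \<open>mu\<close>, against \<open>mu_large\<close>. The
  bounds on \<open>b\<close> then come from \<open>b_lower\<close> and
  \<open>b_upper\<close>.\<close>

lemma bubble:
  fixes \<epsilon> \<eta> :: real
  defines "D \<equiv> 16 / (\<epsilon> * g' mu)"
  assumes \<epsilon>: "0 < \<epsilon>" "\<epsilon> \<le> 1" and \<eta>: "0 < \<eta>" "\<eta> < 1" "C * \<eta> \<le> \<epsilon> / 4"
    and G1: "1 \<le> g' mu" and t0_less: "t0 < mu - D"
    and g'_near: "(1 - \<epsilon>) * g' mu \<le> g' (mu - D)"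
    and C_le: "C \<le> f (mu - D)"
    and mu_large: "16 / \<epsilon> + (4 + 12 * C\<^sup>2 / \<eta>\<^sup>2) / \<eta> < mu"
  obtains r where "0 < r" "r < \<eta>" "a r = 4 - \<epsilon>" "mu - D \<le> u r" "\<epsilon> / 2 \<le> b r" "b r \<le> 11 * \<epsilon>"
proof -
  obtain r2 where r2: "r2 \<in> {0..1}" "u r2 = t0"
    using radius_level[of t0] t0_nonneg mu_gt by auto
  \<comment> \<open>The estimates for \<open>b\<close> are available only while
    \<open>u >= t0\<close>, that is up to \<open>r2\<close>; it turns out that the minimum is
    \<open>\<eta>\<close>.\<close>
  define \<rho> where "\<rho> = min \<eta> r2"
  have "r2 \<noteq> 0" using r2 u_0 mu_gt by auto
  then have \<rho>: "0 < \<rho>" "\<rho> \<le> \<eta>" "\<rho> \<le> r2" "\<rho> < 1" using r2 \<eta> by (auto simp: \<rho>_def)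
  have u_ge: "t0 \<le> u s" if "0 \<le> s" "s \<le> \<rho>" for s
    using u_antimono[of s r2] r2 that \<rho> by auto
  have C_le_\<epsilon>: "C * s \<le> \<epsilon> / 4" if "s \<le> \<eta>" for s
    using \<eta>(3) mult_left_mono[OF that, of C] C_ge_1 by linarith
  have drop: "mu - D \<le> u s" if "0 \<le> s" "s \<le> \<rho>" "a s \<le> 4 - \<epsilon>" for s
    using height_drop[of s \<epsilon>] that u_ge[of s] C_le_\<epsilon>[of s] \<rho> \<epsilon> unfolding D_def by simp
  have D_le: "D \<le> 16 / \<epsilon>"
    unfolding D_def using \<epsilon> G1 by (simp add: frac_le)
  have "4 - \<epsilon> < a \<rho>"
  proof (rule ccontr)
    assume "\<not> 4 - \<epsilon> < a \<rho>"
    then have a\<rho>: "a \<rho> \<le> 4 - \<epsilon>" by simp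
    then have u\<rho>: "mu - D \<le> u \<rho>" using drop \<rho> by simp
    then have "\<rho> \<noteq> r2" using t0_less r2 by auto
    then have "\<rho> = \<eta>" by (auto simp: \<rho>_def min_def split: if_splits)
    note u\<eta> = u\<rho>[unfolded this] and a\<eta> = a\<rho>[unfolded this]
    have t0\<eta>: "t0 \<le> u \<eta>" using u\<eta> t0_less by simp
    \<comment> \<open>For a crude bound the choice \<open>\<theta> = 0\<close> in
      \<open>b_upper\<close> suffices.\<close>
    have "b \<eta> \<le> a \<eta> * (2 + C * \<eta>)"
      using b_upper[of \<eta> 0] \<eta> t0\<eta> g'_pos[OF t0\<eta>] by simp
    also have "\<dots> \<le> 4 * 3"
      using a\<eta> a_nonneg[of \<eta>] \<eta> \<epsilon> C_ge_1 by (intro mult_mono) auto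
    finally have b\<eta>: "b \<eta> \<le> 12" by simp
    have "g' mu * lam * f (u \<eta>) * \<eta>\<^sup>2 * 1 \<le> g' mu * lam * f (u \<eta>) * \<eta>\<^sup>2 * (C * h \<eta>)"
      using h_lower[of \<eta>] \<eta> G_pos lam_pos f_nonneg[OF u_nonneg[of \<eta>]]
      by (intro mult_left_mono) auto
    also have "\<dots> = C * b \<eta>" by (simp add: b_def)
    also have "\<dots> \<le> C * 12" using b\<eta> C_ge_1 by (intro mult_left_mono) auto
    finally have Glf: "g' mu * lam * f (u \<eta>) \<le> 12 * C / \<eta>\<^sup>2"
      using \<eta> by (simp add: field_simps)
    have f_le: "f (u s) \<le> f (u \<eta>)" if "\<eta> \<le> s" "s \<le> 1" for s
    proof (cases "t0 \<le> u s")
      case True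
      then show ?thesis
        using u_antimono[of \<eta> s] that \<eta> g_mono[OF True] f_exp[OF True] f_exp[OF t0\<eta>] by simp
    next
      case False
      \<comment> \<open>Below \<open>t0\<close> monotonicity of \<open>f\<close> is not known; there
        \<open>f\<close> is bounded by \<open>C\<close>, which \<open>f\<close> exceeds or equals at
        height \<open>mu - D\<close>.\<close>
      then have "f (u s) \<le> C" using f_bound[of "u s"] u_nonneg[of s] that \<eta> by simp
      also have "\<dots> \<le> f (mu - D)" by (rule C_le)
      also have "\<dots> \<le> f (u \<eta>)"
        using f_exp[OF t0\<eta>] f_exp[of "mu - D"] t0_less u\<eta> g_mono[of "mu - D" "u \<eta>"] by simp
      finally show ?thesis .
    qed
    \<comment> \<open>At \<open>\<eta>\<close> the mass is at most \<open>4\<close>, and beyond it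
      \<open>a'\<close> is at most \<open>12 C^2/\<eta>^2\<close> on an interval of length below
      \<open>1\<close>.\<close>
    define A where "A = 4 + 12 * C\<^sup>2 / \<eta>\<^sup>2"
    have a_le: "a s \<le> A" if s: "\<eta> \<le> s" "s \<le> 1" for s
    proof -
      define B where "B = 12 * C\<^sup>2 / \<eta>\<^sup>2"
      have "a s - B * s \<le> a \<eta> - B * \<eta>"
      proof (rule deriv_nonpos_imp_ge[where F = "\<lambda>s. a s - B * s" and F' = "\<lambda>s. b s / s - B"])
        show "continuous_on {\<eta>..s} (\<lambda>s. a s - B * s)"
          using s \<eta> by (intro continuous_intros continuous_on_subset[OF a_cont]) auto
        fix x assume x: "\<eta> < x" "x < s"
        show "((\<lambda>s. a s - B * s) has_real_derivative b x / x - B) (at x)"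
          using x s \<eta> by (auto intro!: derivative_eq_intros a_deriv)
        have "b x / x = (g' mu * lam * f (u x)) * (h x * x)"
          using x \<eta> by (simp add: b_def power2_eq_square)
        also have "\<dots> \<le> (g' mu * lam * f (u \<eta>)) * (C * 1)"
          using f_le[of x] h_upper[of x] h_pos[of x] x s \<eta> G_pos lam_pos C_ge_1
            f_nonneg[OF u_nonneg[of \<eta>]] f_nonneg[OF u_nonneg[of x]]
          by (intro mult_mono) auto
        also have "\<dots> \<le> 12 * C / \<eta>\<^sup>2 * (C * 1)"
          using Glf C_ge_1 by (intro mult_right_mono) auto
        also have "\<dots> = B" by (simp add: B_def power2_eq_square)
        finally show "b x / x - B \<le> 0" by simp
      qed (use s in auto)
      moreover have "0 \<le> B" by (simp add: B_def)
      moreover have "B * s \<le> B * 1 + B * \<eta>"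
        using s \<eta> \<open>0 \<le> B\<close> by (simp add: mult_left_le add_increasing2)
      ultimately show ?thesis using a\<eta> \<epsilon> unfolding A_def B_def by linarith
    qed
    have A_pos: "0 < A" unfolding A_def by (simp add: add_pos_nonneg)
    have "u \<eta> + A / (g' mu * \<eta>) * \<eta> \<le> u 1 + A / (g' mu * \<eta>) * 1"
    proof (rule deriv_nonneg_imp_le[where F = "\<lambda>s. u s + A / (g' mu * \<eta>) * s"
          and F' = "\<lambda>s. u' s + A / (g' mu * \<eta>)"])
      show "continuous_on {\<eta>..1} (\<lambda>s. u s + A / (g' mu * \<eta>) * s)"
        using \<eta> G_pos by (intro continuous_intros continuous_on_subset[OF u_cont]) auto
      fix x assume x: "\<eta> < x" "x < 1"
      show "((\<lambda>s. u s + A / (g' mu * \<eta>) * s) has_real_derivative u' x + A / (g' mu * \<eta>)) (at x)"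
        using x \<eta> G_pos by (auto intro!: derivative_eq_intros u_deriv)
      have "a x / (g' mu * x) \<le> A / (g' mu * \<eta>)"
        using a_le[of x] a_nonneg[of x] x \<eta> G_pos A_pos by (intro frac_le) auto
      then show "0 \<le> u' x + A / (g' mu * \<eta>)" using x \<eta> by (simp add: u'_eq)
    qed (use \<eta> in auto)
    then have "u \<eta> \<le> A / (g' mu * \<eta>)"
      using u_1 A_pos \<eta> G_pos by (smt (verit) divide_pos_pos mult_pos_pos mult_cancel_left2)
    also have "\<dots> \<le> A / \<eta>"
      using A_pos \<eta> G1 by (intro divide_left_mono) auto
    finally show False using u\<eta> D_le mu_large unfolding A_def by linarith
  qed
  then obtain r where r: "0 \<le> r" "r \<le> \<rho>" "a r = 4 - \<epsilon>"
    using IVT'[of a 0 "4 - \<epsilon>" \<rho>] a_0 \<epsilon> \<rho> continuous_on_subset[OF a_cont, of "{0..\<rho>}"] by auto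
  have "r \<noteq> 0" using r a_0 \<epsilon> by auto
  moreover have "r \<noteq> \<rho>" using r \<open>4 - \<epsilon> < a \<rho>\<close> by auto
  ultimately have r': "0 < r" "r < \<eta>" "r < 1" using r \<rho> by auto
  have ur: "mu - D \<le> u r" using drop r by simp
  then have t0r: "t0 \<le> u r" using t0_less by simp
  have Cr: "C * r \<le> \<epsilon> / 4" using C_le_\<epsilon> r' by simp
  have "\<epsilon> / 2 \<le> (4 - \<epsilon>) * (\<epsilon> / 4)" using \<epsilon> by (simp add: field_simps)
  also have "\<dots> \<le> (4 - \<epsilon>) * (2 - C * r - (4 - \<epsilon>) / 2)"
  proof (rule mult_left_mono)
    show "\<epsilon> / 4 \<le> 2 - C * r - (4 - \<epsilon>) / 2" using Cr by argo
  qed (use \<epsilon> in simp)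
  also have "\<dots> \<le> b r" using b_lower[of r] r r' t0r by simp
  finally have bl: "\<epsilon> / 2 \<le> b r" .
  have "(1 - \<epsilon>) * g' mu \<le> g' (u r)"
    using g'_near g'_mono[of "mu - D" "u r"] t0_less ur by simp
  \<comment> \<open>The bracket is at most
    \<open>\<epsilon>/4 + 5 \<epsilon>/2 = 11 \<epsilon>/4\<close>, and its factor is at most
    \<open>4\<close>: this is the constant \<open>11\<close>.\<close>
  then have "b r \<le> (4 - \<epsilon>) * (2 + C * r - (1 - \<epsilon>) * (4 - \<epsilon>) / 2)"
    using b_upper[of r "1 - \<epsilon>"] r r' t0r by simp
  also have "\<dots> \<le> (4 - \<epsilon>) * (11 / 4 * \<epsilon>)"
  proof (rule mult_left_mono)
    show "2 + C * r - (1 - \<epsilon>) * (4 - \<epsilon>) / 2 \<le> 11 / 4 * \<epsilon>"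
    proof -
      have "(1 - \<epsilon>) * (4 - \<epsilon>) / 2 = 2 - 5 / 2 * \<epsilon> + \<epsilon> * \<epsilon> / 2"
        by (simp add: field_simps)
      then show ?thesis using Cr zero_le_square[of \<epsilon>] by linarith
    qed
  qed (use \<epsilon> in auto)
  also have "\<dots> \<le> 4 * (11 / 4 * \<epsilon>)" using \<epsilon> by (intro mult_right_mono) auto
  finally have "b r \<le> 11 * \<epsilon>" by simp
  then show ?thesis using that r r' ur bl by blast
qed

text \<open>Since \<open>g\<close> lies below its chords and \<open>u\<close> drops by at least \<open>a r / g' mu\<close> per unit of \<open>ln r\<close>,
  the chord condition makes \<open>b\<close> decay exponentially in the drop of \<open>u\<close>.\<close>
lemma tail_mass:
  assumes r: "0 < r" "r < 1" and ar: "3 \<le> a r" and ur: "t0 < u r" and c: "0 < c"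
    and chord: "(2 / a r + c) * g' mu * (u r - t0) \<le> g (u r) - g t0"
  shows "a 1 \<le> a r + C\<^sup>2 * b r / (3 * c) + g' mu * lam * C\<^sup>2"
proof -
  obtain r2 where r2: "r2 \<in> {0..1}" "u r2 = t0"
    using radius_level[of t0] t0_nonneg mu_gt by auto
  have r_r2: "r < r2"
    using u_antimono[of r2 r] r2 r ur by (cases "r < r2") auto
  define E where "E s = exp (- (c * g' mu * (u r - u s)))" for s
  have b_le: "b s \<le> C\<^sup>2 * b r * E s" if s: "r < s" "s < r2" for s
  proof -
    have us: "t0 \<le> u s" "u s \<le> u r"
      using u_antimono[of s r2] u_antimono[of r s] r2 s r by auto
    \<comment> \<open>Beyond \<open>r\<close> the mass is at least \<open>a r\<close>, so
      \<open>u\<close> falls at least this fast in \<open>ln s\<close>; hence the growth of the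
      factor \<open>s^2\<close> in \<open>b\<close> is controlled by the drop of
      \<open>u\<close>.\<close>
    have "u s + a r / g' mu * ln s \<le> u r + a r / g' mu * ln r"
    proof (rule deriv_nonpos_imp_ge[where F = "\<lambda>s. u s + a r / g' mu * ln s"
          and F' = "\<lambda>s. u' s + a r / g' mu * (1 / s)"])
      show "continuous_on {r..s} (\<lambda>s. u s + a r / g' mu * ln s)"
        using r s r2 G_pos by (intro continuous_intros continuous_on_subset[OF u_cont]) auto
      fix x assume x: "r < x" "x < s"
      show "((\<lambda>s. u s + a r / g' mu * ln s) has_real_derivative u' x + a r / g' mu * (1 / x)) (at x)"
        using x r s r2 G_pos by (auto intro!: derivative_eq_intros u_deriv)
      have "a r / (g' mu * x) \<le> a x / (g' mu * x)"
        using a_mono[of r x] x r s r2 G_pos by (intro divide_right_mono) auto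
      then show "u' x + a r / g' mu * (1 / x) \<le> 0" using x r by (simp add: u'_eq)
    qed (use s in auto)
    then have "a r / g' mu * (ln s - ln r) \<le> u r - u s"
      unfolding right_diff_distrib by linarith
    then have ln_le: "2 * (ln s - ln r) \<le> 2 / a r * g' mu * (u r - u s)"
      using G_pos ar by (simp add: field_simps)
    \<comment> \<open>The slope bound assumed on the chord from \<open>t0\<close> to
      \<open>u r\<close> passes to the steeper chord from \<open>u s\<close> to \<open>u r\<close>.
      Its part \<open>2 / a r\<close> absorbs the growth of \<open>s^2\<close>; the part
      \<open>c\<close> remains as decay.\<close>
    have "((2 / a r + c) * g' mu * (u r - u s)) * (u r - t0)
        = (2 / a r + c) * g' mu * (u r - t0) * (u r - u s)" by simp
    also have "\<dots> \<le> (g (u r) - g t0) * (u r - u s)"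
      using chord us by (intro mult_right_mono) auto
    also have "\<dots> \<le> (g (u r) - g (u s)) * (u r - t0)"
      by (rule chord_slope) (use us in auto)
    finally have "(2 / a r + c) * g' mu * (u r - u s) \<le> g (u r) - g (u s)"
      using ur by (simp add: mult_le_cancel_right)
    then have expo: "2 * (ln s - ln r) + g (u s) \<le> g (u r) + - (c * g' mu * (u r - u s))"
      using ln_le by (simp add: algebra_simps)
    have "h s \<le> C" using h_upper[of s] s r r2 by simp
    also have "\<dots> \<le> C * (C * h r)" using h_lower[of r] r C_ge_1 by simp
    finally have h_le: "h s \<le> C\<^sup>2 * h r" by (simp add: power2_eq_square)
    have "s\<^sup>2 = exp (2 * (ln s - ln r)) * r\<^sup>2"
      using s r by (simp add: exp_diff right_diff_distrib exp_double power_divide)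
    then have "b s = (g' mu * lam * r\<^sup>2) * (h s * exp (2 * (ln s - ln r) + g (u s)))"
      using f_exp[OF us(1)] by (simp add: b_def exp_add)
    also have "\<dots> \<le> (g' mu * lam * r\<^sup>2)
        * ((C\<^sup>2 * h r) * exp (g (u r) + - (c * g' mu * (u r - u s))))"
      using h_le expo G_pos lam_pos h_pos[of s] h_pos[of r] s r r2
      by (intro mult_left_mono mult_mono) auto
    also have "\<dots> = C\<^sup>2 * b r * E s"
      using f_exp[of "u r"] ur by (simp add: b_def E_def exp_add exp_minus exp_diff field_simps)
    finally show ?thesis .
  qed
  have E_deriv: "(E has_real_derivative c * g' mu * u' x * E x) (at x)" if "r < x" "x < r2" for x
    unfolding E_def using that r r2
    by (auto intro!: derivative_eq_intros u_deriv)
  \<comment> \<open>Chosen so that \<open>a + M E\<close> decreases: \<open>g' mu u' = - a/x\<close>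
    with \<open>a >= 3\<close>, so \<open>M E\<close> falls at rate at least
    \<open>3 c M E/x = C^2 b(r) E/x\<close>, which dominates \<open>b/x\<close>.\<close>
  define M where "M = C\<^sup>2 * b r / (3 * c)"
  have M: "0 \<le> M" using c b_nonneg[of r] r by (simp add: M_def)
  have "a r2 + M * E r2 \<le> a r + M * E r"
  proof (rule deriv_nonpos_imp_ge[where F = "\<lambda>x. a x + M * E x"
        and F' = "\<lambda>x. b x / x + M * (c * g' mu * u' x * E x)"])
    show "continuous_on {r..r2} (\<lambda>x. a x + M * E x)"
      unfolding E_def using r r2
      by (intro continuous_intros continuous_on_subset[OF u_cont] continuous_on_subset[OF a_cont]) auto
    fix x assume x: "r < x" "x < r2"
    show "((\<lambda>x. a x + M * E x) has_real_derivative b x / x + M * (c * g' mu * u' x * E x)) (at x)"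
      using x r r2 by (intro DERIV_add DERIV_cmult a_deriv E_deriv) auto
    have "c * M * E x * 3 \<le> c * M * E x * a x"
      using a_mono[of r x] ar x r r2 c M by (intro mult_left_mono) (auto simp: E_def)
    moreover have "c * M * E x * 3 = C\<^sup>2 * b r * E x" using c by (simp add: M_def)
    ultimately have "b x / x \<le> c * M * E x * a x / x"
      using b_le[OF x] x r by (intro divide_right_mono) auto
    moreover have "M * (c * g' mu * u' x * E x) = - (c * M * E x * a x / x)"
      using x r G_pos by (simp add: u'_eq)
    ultimately show "b x / x + M * (c * g' mu * u' x * E x) \<le> 0" by simp
  qed (use r_r2 in auto)
  moreover have "0 \<le> M * E r2" "E r = 1" using M by (auto simp: E_def)
  ultimately have ar2: "a r2 \<le> a r + M" by simp
  \<comment> \<open>Beyond \<open>r2\<close> the solution lies below \<open>t0\<close>, where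
    \<open>f <= C\<close>; this bounds \<open>a'\<close> by \<open>B\<close>.\<close>
  define B where "B = g' mu * lam * C\<^sup>2"
  have "a 1 - B * 1 \<le> a r2 - B * r2"
  proof (rule deriv_nonpos_imp_ge[where F = "\<lambda>s. a s - B * s" and F' = "\<lambda>s. b s / s - B"])
    show "continuous_on {r2..1} (\<lambda>s. a s - B * s)"
      using r2 by (intro continuous_intros continuous_on_subset[OF a_cont]) auto
    fix x assume x: "r2 < x" "x < 1"
    show "((\<lambda>s. a s - B * s) has_real_derivative b x / x - B) (at x)"
      using x r r_r2 by (auto intro!: derivative_eq_intros a_deriv)
    have "u x \<le> t0" "0 \<le> u x" using u_antimono[of r2 x] u_nonneg[of x] r2 x by auto
    then have fx: "f (u x) \<le> C" "0 \<le> f (u x)" using f_bound f_nonneg by auto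
    have "b x / x = g' mu * lam * (h x * x * f (u x))"
      using x r r_r2 by (simp add: b_def power2_eq_square)
    also have "\<dots> \<le> g' mu * lam * (C * 1 * C)"
      using fx h_upper[of x] h_pos[of x] x r r_r2 G_pos lam_pos C_ge_1
      by (intro mult_left_mono mult_mono) auto
    also have "\<dots> = B" by (simp add: B_def power2_eq_square)
    finally show "b x / x - B \<le> 0" by simp
  qed (use r2 in auto)
  moreover have "0 \<le> B * r2" using G_pos lam_pos r2 by (simp add: B_def)
  ultimately have "a 1 \<le> a r2 + B" by simp
  then show ?thesis using ar2 unfolding M_def B_def by simp
qed

section \<open>Heights, \<open>lam\<close> and the integrals in terms of the mass\<close>

text \<open>Integrates \<open>g' mu u' = - a/r\<close> from \<open>r\<close> up to \<open>1\<close>,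
  where \<open>u\<close> vanishes.\<close>

lemma height_bounds:
  assumes r: "0 < r" "r < 1" and l: "\<And>s. r < s \<Longrightarrow> s < 1 \<Longrightarrow> l \<le> a s \<and> a s \<le> m"
  shows "l * ln (1 / r) \<le> g' mu * u r" "g' mu * u r \<le> m * ln (1 / r)"
proof -
  have "g' mu * u 1 + l * ln 1 \<le> g' mu * u r + l * ln r"
  proof (rule deriv_nonpos_imp_ge[where F = "\<lambda>s. g' mu * u s + l * ln s"
        and F' = "\<lambda>s. g' mu * u' s + l * (1 / s)"])
    show "continuous_on {r..1} (\<lambda>s. g' mu * u s + l * ln s)"
      using r by (intro continuous_intros continuous_on_subset[OF u_cont]) auto
    fix x assume x: "r < x" "x < 1"
    show "((\<lambda>s. g' mu * u s + l * ln s) has_real_derivative g' mu * u' x + l * (1 / x)) (at x)"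
      using x r by (auto intro!: derivative_eq_intros u_deriv)
    show "g' mu * u' x + l * (1 / x) \<le> 0"
      using l[of x] x r G_pos by (simp add: u'_eq divide_right_mono)
  qed (use r in auto)
  then show "l * ln (1 / r) \<le> g' mu * u r" using r u_1 by (simp add: ln_div)
  have "g' mu * u r + m * ln r \<le> g' mu * u 1 + m * ln 1"
  proof (rule deriv_nonneg_imp_le[where F = "\<lambda>s. g' mu * u s + m * ln s"
        and F' = "\<lambda>s. g' mu * u' s + m * (1 / s)"])
    show "continuous_on {r..1} (\<lambda>s. g' mu * u s + m * ln s)"
      using r by (intro continuous_intros continuous_on_subset[OF u_cont]) auto
    fix x assume x: "r < x" "x < 1"
    show "((\<lambda>s. g' mu * u s + m * ln s) has_real_derivative g' mu * u' x + m * (1 / x)) (at x)"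
      using x r by (auto intro!: derivative_eq_intros u_deriv)
    show "0 \<le> g' mu * u' x + m * (1 / x)"
      using l[of x] x r G_pos by (simp add: u'_eq divide_right_mono)
  qed (use r in auto)
  then show "g' mu * u r \<le> m * ln (1 / r)" using r u_1 by (simp add: ln_div)
qed

text \<open>The logarithm of the definition of \<open>b\<close>, solved for \<open>lam\<close>. At a
  bubble radius \<open>g (u r) = g mu + O(1)\<close>, \<open>ln (b r)\<close> is bounded and
  \<open>4 ln (1/r)\<close> is close to \<open>mu g' mu\<close>, roughly \<open>p g mu\<close>; this
  is where \<open>1 - p/2\<close> comes from.\<close>

lemma ln_lam_eq:
  assumes r: "0 < r" "r < 1" and ur: "t0 \<le> u r"
  shows "ln (1 / lam) = g (u r) + ln (h r) - 2 * ln (1 / r) - ln (b r) + ln (g' mu)"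
proof -
  have "ln (b r) = ln (g' mu) + ln lam + ln (h r) + 2 * ln r + g (u r)"
    using r G_pos lam_pos h_pos[of r] f_exp[OF ur]
    by (simp add: b_def ln_mult ln_realpow)
  then show ?thesis using r lam_pos by (simp add: ln_div)
qed

lemma mass_integral:
  assumes "0 \<le> r" "r \<le> s" "s \<le> 1"
  shows "((\<lambda>x. g' mu * (lam * h x * f (u x) * x)) has_integral (a s - a r)) {r..s}"
proof (rule fundamental_theorem_of_calculus_interior)
  show "continuous_on {r..s} a" using assms by (intro continuous_on_subset[OF a_cont]) auto
  fix x assume x: "x \<in> {r<..<s}"
  then have "b x / x = g' mu * (lam * h x * f (u x) * x)"
    using assms by (simp add: b_def power2_eq_square)
  then show "(a has_vector_derivative g' mu * (lam * h x * f (u x) * x)) (at x)"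
    using a_deriv[of x] x assms by (simp add: has_real_derivative_iff_has_vector_derivative)
qed (use assms in auto)

lemma mass_eq: "g' mu * integral {0..1} (\<lambda>x. lam * h x * f (u x) * x) = a 1"
  using integral_unique[OF mass_integral[of 0 1]] a_0 by simp

lemma f'_mass_integrable:
  assumes "0 \<le> r" "s \<le> 1"
  shows "(\<lambda>x. lam * h x * f' (u x) * x) integrable_on {r..s}"
proof -
  have "continuous_on {0..1} (\<lambda>x. f' (u x))"
    by (rule continuous_on_compose2[OF f'_cont u_cont]) (use u_nonneg in auto)
  then have "continuous_on {0..1} (\<lambda>x. lam * h x * f' (u x) * x)"
    by (intro continuous_intros h_cont)
  then show ?thesis using assms
    by (intro integrable_continuous_real) (auto elim: continuous_on_subset)
qed

text \<open>Where \<open>u >= t0\<close>, \<open>f' = g'(u) f\<close> lies between \<open>0\<close>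
  and \<open>g' mu f\<close>; elsewhere \<open>f'\<close> is at most \<open>C\<close> in absolute
  value. The weight \<open>lam h x\<close> is at most \<open>lam C\<close>, hence the error
  \<open>lam C^2\<close>.\<close>

lemma f'_mass_pointwise:
  assumes x: "x \<in> {0..1}"
  shows "lam * h x * f' (u x) * x \<le> g' mu * (lam * h x * f (u x) * x) + lam * C\<^sup>2"
    and "- (lam * C\<^sup>2) \<le> lam * h x * f' (u x) * x"
proof -
  have ux: "0 \<le> u x" "u x \<le> mu" using u_nonneg[of x] u_antimono[of 0 x] u_0 x by auto
  have hx: "0 \<le> h x * x" "h x * x \<le> C"
    using h_pos[of x] h_upper[of x] x C_ge_1 mult_mono[of "h x" C x 1] by auto
  have w: "0 \<le> lam * h x * x" "lam * h x * x \<le> lam * C"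
    using lam_pos hx by (simp_all add: mult.assoc)
  have C2: "lam * C * C = lam * C\<^sup>2" by (simp add: power2_eq_square)
  have fp: "f' (u x) \<le> g' mu * f (u x) + C" "- C \<le> f' (u x)"
  proof -
    show "f' (u x) \<le> g' mu * f (u x) + C"
    proof (cases "t0 \<le> u x")
      case True
      then show ?thesis using f'_exp[OF True] g'_mono[OF True ux(2)] f_nonneg[OF ux(1)] C_ge_1
        by (simp add: add_increasing2 mult_right_mono)
    next
      case False
      then have "f' (u x) \<le> C" using f'_bound[of "u x"] ux by simp
      moreover have "0 \<le> g' mu * f (u x)" using G_pos f_nonneg[OF ux(1)] by simp
      ultimately show ?thesis by simp
    qed
    show "- C \<le> f' (u x)"
    proof (cases "t0 \<le> u x")
      case True
      then have "0 \<le> f' (u x)" using f'_exp g'_pos[OF True] f_nonneg[OF ux(1)] by simp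
      then show ?thesis using C_ge_1 by simp
    next
      case False then show ?thesis using f'_bound[of "u x"] ux by simp
    qed
  qed
  have "(lam * h x * x) * f' (u x) \<le> (lam * h x * x) * (g' mu * f (u x)) + (lam * h x * x) * C"
    using mult_left_mono[OF fp(1) w(1)] by (simp add: distrib_left)
  also have "\<dots> \<le> (lam * h x * x) * (g' mu * f (u x)) + lam * C\<^sup>2"
    using mult_right_mono[OF w(2), of C] C_ge_1 C2 by simp
  finally show "lam * h x * f' (u x) * x \<le> g' mu * (lam * h x * f (u x) * x) + lam * C\<^sup>2"
    by (simp add: mult_ac)
  have "- (lam * C\<^sup>2) \<le> (lam * h x * x) * (- C)"
    using mult_right_mono[OF w(2), of C] C_ge_1 C2 by simp
  also have "\<dots> \<le> (lam * h x * x) * f' (u x)" by (rule mult_left_mono[OF fp(2) w(1)])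
  finally show "- (lam * C\<^sup>2) \<le> lam * h x * f' (u x) * x" by (simp add: mult_ac)
qed

lemma f'_mass_upper: "integral {0..1} (\<lambda>x. lam * h x * f' (u x) * x) \<le> a 1 + lam * C\<^sup>2"
proof -
  have "((\<lambda>x. g' mu * (lam * h x * f (u x) * x) + lam * C\<^sup>2) has_integral (a 1 - a 0 + lam * C\<^sup>2)) {0..1}"
    using has_integral_add[OF mass_integral[of 0 1] has_integral_const_real[of "lam * C\<^sup>2" 0 1]] by simp
  then show ?thesis
    using has_integral_le[OF integrable_integral[OF f'_mass_integrable[of 0 1]]] f'_mass_pointwise(1) a_0
    by fastforce
qed

text \<open>On the disc of radius \<open>r\<close> one has
  \<open>f' = g'(u) f >= \<theta> g' mu f\<close>, which yields \<open>\<theta> a r\<close>;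
  outside, the pointwise lower bound loses at most \<open>lam C^2\<close>.\<close>

lemma f'_mass_lower:
  assumes r: "0 \<le> r" "r \<le> 1" and ur: "t0 \<le> u r" and \<theta>: "\<theta> * g' mu \<le> g' (u r)"
  shows "\<theta> * a r - lam * C\<^sup>2 \<le> integral {0..1} (\<lambda>x. lam * h x * f' (u x) * x)"
proof -
  let ?F = "\<lambda>x. lam * h x * f' (u x) * x"
  have "((\<lambda>x. \<theta> * (g' mu * (lam * h x * f (u x) * x))) has_integral \<theta> * (a r - a 0)) {0..r}"
    using has_integral_mult_right[OF mass_integral[of 0 r]] r by simp
  moreover have "\<theta> * (g' mu * (lam * h x * f (u x) * x)) \<le> ?F x" if x: "x \<in> {0..r}" for x
  proof -
    have ux: "t0 \<le> u x" "u r \<le> u x" using u_antimono[of x r] x r ur by auto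
    have "\<theta> * g' mu \<le> g' (u x)" using g'_mono[OF ur ux(2)] \<theta> by simp
    then have "(\<theta> * g' mu) * (lam * h x * f (u x) * x) \<le> g' (u x) * (lam * h x * f (u x) * x)"
      using lam_pos h_pos[of x] x r f_nonneg[OF u_nonneg[of x]] by (intro mult_right_mono) auto
    then show ?thesis using f'_exp[OF ux(1)] by (simp add: mult_ac)
  qed
  ultimately have 1: "\<theta> * a r \<le> integral {0..r} ?F"
    using has_integral_le[OF _ integrable_integral[OF f'_mass_integrable[of 0 r]]] r a_0 by fastforce
  have "integral {r..1} (\<lambda>x. - (lam * C\<^sup>2)) \<le> integral {r..1} ?F"
    using f'_mass_pointwise(2) r f'_mass_integrable[of r 1] by (intro integral_le) auto
  moreover have "- (lam * C\<^sup>2) \<le> integral {r..1} (\<lambda>x. - (lam * C\<^sup>2))"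
    using r lam_pos by (simp add: mult_left_le_one_le mult.commute mult_left_le)
  moreover have "integral {0..r} ?F + integral {r..1} ?F = integral {0..1} ?F"
    using r f'_mass_integrable[of 0 1] by (intro Henstock_Kurzweil_Integration.integral_combine) auto
  ultimately show ?thesis using 1 by linarith
qed

text \<open>The equation is given in the open interval and reaches \<open>r = 1\<close> by
  continuity of \<open>u''\<close>. The closure is taken from \<open>r/2\<close> on, to stay away
  from the singularity at \<open>0\<close>.\<close>

lemma u''_eq:
  assumes "0 < r" "r \<le> 1" shows "u'' r = - u' r / r - lam * h r * f (u r)"
proof -
  define F where "F s = u'' s + u' s / s + lam * h s * f (u s)" for s
  have F0: "F s = 0" if "s \<in> {r/2<..<1}" for s
    using u_eq[of s] that assms by (simp add: F_def)
  have "{r/2..1} = closure {r/2<..<1}" using assms by (simp add: closure_greaterThanLessThan)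
  moreover have "continuous_on {r/2..1} F"
    unfolding F_def using assms
    by (intro continuous_intros continuous_on_subset[OF u''_cont] continuous_on_subset[OF u'_cont]
      continuous_on_subset[OF h_cont] continuous_on_subset[OF fu_cont]) auto
  ultimately have "F r = 0"
    using continuous_constant_on_closure[of "{r/2<..<1}" F 0 r] F0 assms by auto
  then show ?thesis by (simp add: F_def)
qed

text \<open>Closeness of \<open>a\<close> to \<open>4\<close> transfers to \<open>u\<close> by
  integration, to \<open>u'\<close> because \<open>g' mu u' = - a/r\<close>, and to
  \<open>u''\<close> through the equation, whose source term adds
  \<open>g' mu lam C B\<close>.\<close>

lemma C2_close:
  assumes r: "0 < \<eta>" "\<eta> < 1" "r \<in> {\<eta>..1}" and close: "\<forall>s\<in>{\<eta>..1}. \<bar>a s - 4\<bar> \<le> \<delta>"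
  shows "\<bar>g' mu * u r - 4 * ln (1 / r)\<bar> \<le> \<delta> * ln (1 / \<eta>)"
    and "\<bar>g' mu * u' r - (- 4 / r)\<bar> \<le> \<delta> / \<eta>"
    and "f (u r) \<le> B \<Longrightarrow> \<bar>g' mu * u'' r - 4 / r\<^sup>2\<bar> \<le> \<delta> / \<eta>\<^sup>2 + g' mu * lam * C * B"
proof -
  have \<delta>: "\<bar>a s - 4\<bar> \<le> \<delta>" if "\<eta> \<le> s" "s \<le> 1" for s
    using close that by simp
  have \<delta>0: "0 \<le> \<delta>" using \<delta>[of 1] r by simp
  have r0: "0 < r" "r \<le> 1" using r by auto
  have ln_le: "0 \<le> ln (1 / r)" "ln (1 / r) \<le> ln (1 / \<eta>)" using r by (auto simp: ln_div)
  show "\<bar>g' mu * u r - 4 * ln (1 / r)\<bar> \<le> \<delta> * ln (1 / \<eta>)"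
  proof (cases "r = 1")
    case True
    then show ?thesis using u_1 \<delta>0 ln_le by simp
  next
    case False
    then have "r < 1" using r by simp
    moreover have "4 - \<delta> \<le> a s \<and> a s \<le> 4 + \<delta>" if "r < s" "s < 1" for s
      using \<delta>[of s] that r by auto
    ultimately have "(4 - \<delta>) * ln (1 / r) \<le> g' mu * u r" "g' mu * u r \<le> (4 + \<delta>) * ln (1 / r)"
      using height_bounds[of r "4 - \<delta>" "4 + \<delta>"] r0 by blast+
    then have "\<bar>g' mu * u r - 4 * ln (1 / r)\<bar> \<le> \<delta> * ln (1 / r)"
      by (simp add: abs_le_iff algebra_simps)
    also have "\<dots> \<le> \<delta> * ln (1 / \<eta>)" by (rule mult_left_mono[OF ln_le(2) \<delta>0])
    finally show ?thesis .
  qed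
  have ar: "\<bar>a r - 4\<bar> \<le> \<delta>" using \<delta> r by simp
  have Gu': "g' mu * u' r = - a r / r" using r0 by (simp add: a_def)
  have "\<bar>g' mu * u' r - (- 4 / r)\<bar> = \<bar>a r - 4\<bar> / r"
    using r0 unfolding Gu' by (simp add: abs_minus_commute flip: diff_divide_distrib)
  also have "\<dots> \<le> \<delta> / \<eta>" using ar \<delta>0 r by (intro frac_le) auto
  finally show "\<bar>g' mu * u' r - (- 4 / r)\<bar> \<le> \<delta> / \<eta>" .
  assume fB: "f (u r) \<le> B"
  have "g' mu * u'' r = - (g' mu * u' r) / r - g' mu * lam * h r * f (u r)"
    unfolding u''_eq[OF r0] by (simp add: right_diff_distrib)
  then have "g' mu * u'' r - 4 / r\<^sup>2 = (a r - 4) / r\<^sup>2 - g' mu * lam * h r * f (u r)"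
    unfolding Gu' by (simp add: power2_eq_square diff_divide_distrib)
  then have "\<bar>g' mu * u'' r - 4 / r\<^sup>2\<bar> \<le> \<bar>(a r - 4) / r\<^sup>2\<bar> + \<bar>g' mu * lam * h r * f (u r)\<bar>"
    by (simp only: abs_triangle_ineq4)
  also have "\<bar>(a r - 4) / r\<^sup>2\<bar> = \<bar>a r - 4\<bar> / r\<^sup>2" by simp
  also have "\<dots> \<le> \<delta> / \<eta>\<^sup>2" using ar \<delta>0 r by (intro frac_le power_mono) auto
  also have "\<bar>g' mu * lam * h r * f (u r)\<bar> = g' mu * lam * (h r * f (u r))"
    using G_pos lam_pos h_pos[of r] f_nonneg[OF u_nonneg[of r]] r0 by simp
  also have "\<dots> \<le> g' mu * lam * (C * B)"
    using G_pos lam_pos h_upper[of r] h_pos[of r] f_nonneg[OF u_nonneg[of r]] r0 fB C_ge_1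
    by (intro mult_left_mono mult_mono) auto
  finally show "\<bar>g' mu * u'' r - 4 / r\<^sup>2\<bar> \<le> \<delta> / \<eta>\<^sup>2 + g' mu * lam * C * B" by (simp add: mult.assoc)
qed

end

section \<open>Sequences of solutions\<close>

text \<open>The solution locale is available only for \<open>t0 < mu n\<close>, where
  \<open>g' (mu n)\<close> is meaningful; \<open>mu_lim\<close> makes this all but finitely many
  indices. The constant \<open>C\<close> does not depend on \<open>n\<close>.\<close>

locale blowup_sequence = subquadratic_growth +
  fixes h h' f f' :: "real \<Rightarrow> real" and u u' u'' :: "nat \<Rightarrow> real \<Rightarrow> real" and C :: real
    and lam mu :: "nat \<Rightarrow> real"
  assumes sol: "t0 < mu n \<Longrightarrow>
      radial_solution g g' g'' t0 q p h h' f f' (u n) (u' n) (u'' n) C (lam n) (mu n)"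
    and mu_lim: "filterlim mu at_top sequentially"
    and f_at_top: "filterlim f at_top at_top"
    and C_ge_1: "1 \<le> C" and lam_pos: "0 < lam n"
begin

abbreviation A :: "nat \<Rightarrow> real \<Rightarrow> real" where
  "A n \<equiv> radial_solution.a g' (u' n) (mu n)"

abbreviation B :: "nat \<Rightarrow> real \<Rightarrow> real" where
  "B n \<equiv> radial_solution.b g' h f (u n) (lam n) (mu n)"

lemma along_mu: "eventually P at_top \<Longrightarrow> \<forall>\<^sub>F n in sequentially. P (mu n)"
  using mu_lim by (simp add: filterlim_iff)

lemma lim_along_mu: "(F \<longlongrightarrow> l) at_top \<Longrightarrow> (\<lambda>n. F (mu n)) \<longlonglongrightarrow> l"
  by (rule filterlim_compose[OF _ mu_lim])

lemma mu_gt_ev: "\<forall>\<^sub>F n in sequentially. t0 < mu n"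
  by (rule along_mu[OF eventually_gt_at_top])

text \<open>The radius \<open>r\<close> separates the bubble, whose mass is \<open>4 - \<epsilon>\<close>, from the tail.\<close>
definition bubble_radius :: "real \<Rightarrow> nat \<Rightarrow> real \<Rightarrow> bool" where
  "bubble_radius \<epsilon> n r \<longleftrightarrow> 0 < r \<and> r < 1 \<and> t0 < mu n \<and> 1 \<le> g' (mu n) \<and>
     A n r = 4 - \<epsilon> \<and> t0 < u n r \<and> g' (mu n) * (mu n - u n r) \<le> 16 / \<epsilon> \<and>
     (1 - \<epsilon>) * g' (mu n) \<le> g' (u n r) \<and> \<epsilon> / 2 \<le> B n r \<and> B n r \<le> 11 * \<epsilon>"

section \<open>Bubble radii along the sequence\<close>

lemma bubble_radius_ev:
  assumes \<epsilon>: "0 < \<epsilon>" "\<epsilon> \<le> 1" and \<eta>: "0 < \<eta>"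
  shows "\<forall>\<^sub>F n in sequentially. \<exists>r<\<eta>. bubble_radius \<epsilon> n r"
proof -
  \<comment> \<open>Small enough for \<open>bubble\<close>, which requires a radius below
    \<open>1\<close> with \<open>C \<zeta> <= \<epsilon>/4\<close>.\<close>
  define \<zeta> where "\<zeta> = min (min \<eta> (1 / 2)) (\<epsilon> / (4 * C))"
  have \<zeta>: "0 < \<zeta>" "\<zeta> < 1" "\<zeta> \<le> \<eta>" using assms C_ge_1 by (auto simp: \<zeta>_def)
  have "\<zeta> \<le> \<epsilon> / (4 * C)" by (simp add: \<zeta>_def)
  then have C\<zeta>: "C * \<zeta> \<le> \<epsilon> / 4" using C_ge_1 by (simp add: field_simps)
  obtain T where T: "\<And>t. T \<le> t \<Longrightarrow> C \<le> f t"
    using f_at_top unfolding filterlim_at_top eventually_at_top_linorder by blast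
  \<comment> \<open>Above this height \<open>f >= C\<close> and the argument strictly exceeds
    \<open>t0\<close>. Since \<open>1 <= g'\<close> gives \<open>D <= 16/\<epsilon>\<close>, it
    suffices that \<open>mu n\<close> exceeds it by \<open>16/\<epsilon>\<close>.\<close>
  define T' where "T' = max (max T (t0 + 1)) 0"
  have g'_ge: "\<forall>\<^sub>F t in at_top. 1 \<le> g' t" using g'_at_top by (simp add: filterlim_at_top)
  have near: "\<forall>\<^sub>F t in at_top. (1 - \<epsilon>) * g' t \<le> g' (t - 16 / \<epsilon> / g' t)"
    by (rule g'_near) (use \<epsilon> in auto)
  have "\<forall>\<^sub>F t in at_top. 1 \<le> g' t \<and> (1 - \<epsilon>) * g' t \<le> g' (t - 16 / \<epsilon> / g' t) \<and>
      T' + 16 / \<epsilon> \<le> t \<and> 16 / \<epsilon> + (4 + 12 * C\<^sup>2 / \<zeta>\<^sup>2) / \<zeta> < t"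
    using near g'_ge eventually_ge_at_top[of "T' + 16 / \<epsilon>"]
      eventually_gt_at_top[of "16 / \<epsilon> + (4 + 12 * C\<^sup>2 / \<zeta>\<^sup>2) / \<zeta>"]
    by eventually_elim blast
  from along_mu[OF this] show ?thesis
  proof eventually_elim
    case (elim n)
    define D where "D = 16 / (\<epsilon> * g' (mu n))"
    have G1: "1 \<le> g' (mu n)" using elim by simp
    have D_eq: "16 / \<epsilon> / g' (mu n) = D" by (simp add: D_def)
    have D_le: "D \<le> 16 / \<epsilon>" using \<epsilon> G1 unfolding D_def by (intro divide_left_mono) auto
    have D_pos: "0 < D" unfolding D_def using \<epsilon> G1 by simp
    have mD: "T' \<le> mu n - D" using elim D_le by linarith
    then have mD': "T \<le> mu n - D" "t0 < mu n - D" by (auto simp: T'_def)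
    then have "t0 < mu n" using D_pos by simp
    then interpret S: radial_solution g g' g'' t0 q p h h' f f' "u n" "u' n" "u'' n" C "lam n" "mu n"
      by (rule sol)
    have nearD: "(1 - \<epsilon>) * g' (mu n) \<le> g' (mu n - D)" using elim unfolding D_eq by blast
    have C_le: "C \<le> f (mu n - D)" by (rule T[OF mD'(1)])
    obtain r where r: "0 < r" "r < \<zeta>" "A n r = 4 - \<epsilon>" "mu n - D \<le> u n r"
        "\<epsilon> / 2 \<le> B n r" "B n r \<le> 11 * \<epsilon>"
      using S.bubble[OF \<epsilon> \<zeta>(1,2) C\<zeta> G1, folded D_def, OF mD'(2) nearD C_le] elim by blast
    have "t0 < u n r" using r mD' by simp
    moreover have "g' (mu n) * (mu n - u n r) \<le> g' (mu n) * D"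
      using r G1 by (intro mult_left_mono) auto
    moreover have "g' (mu n) * D = 16 / \<epsilon>" using G1 by (simp add: D_def)
    moreover have "(1 - \<epsilon>) * g' (mu n) \<le> g' (u n r)"
      using g'_mono[of "mu n - D" "u n r"] mD' r nearD by simp
    ultimately have "bubble_radius \<epsilon> n r"
      using r \<zeta> G1 \<open>t0 < mu n\<close> by (simp add: bubble_radius_def)
    then show ?case using r \<zeta> by (intro exI[of _ r]) auto
  qed
qed

text \<open>By convexity the loss in \<open>g\<close> across the bubble is at most
  \<open>g' mu (mu - u r) <= 16/\<epsilon>\<close>, a constant independent of
  \<open>n\<close>.\<close>

lemma bubble_radiusD:
  assumes "bubble_radius \<epsilon> n r" "0 < \<epsilon>" "\<epsilon> \<le> 1"
  shows "radial_solution g g' g'' t0 q p h h' f f' (u n) (u' n) (u'' n) C (lam n) (mu n)"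
    and "u n r \<le> mu n" "g (mu n) - 16 / \<epsilon> \<le> g (u n r)" "g (u n r) \<le> g (mu n)"
proof -
  have D: "0 < r" "r < 1" "t0 < mu n" "t0 < u n r" "g' (mu n) * (mu n - u n r) \<le> 16 / \<epsilon>"
    using assms(1) by (auto simp: bubble_radius_def)
  show *: "radial_solution g g' g'' t0 q p h h' f f' (u n) (u' n) (u'' n) C (lam n) (mu n)"
    by (rule sol[OF D(3)])
  interpret S: radial_solution g g' g'' t0 q p h h' f f' "u n" "u' n" "u'' n" C "lam n" "mu n" by (rule *)
  show le: "u n r \<le> mu n" using S.u_antimono[of 0 r] S.u_0 D by simp
  show "g (mu n) - 16 / \<epsilon> \<le> g (u n r)" using chord_upper[of "u n r" "mu n"] le D by simp
  show "g (u n r) \<le> g (mu n)" using g_mono[of "u n r" "mu n"] le D by simp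
qed

text \<open>Lets parameters be chosen by a limit at \<open>0\<close> from the right instead of an
  explicit formula.\<close>

lemma small_parameter:
  assumes "eventually P (at_right (0::real))"
  obtains \<epsilon> where "0 < \<epsilon>" "\<epsilon> \<le> 1" "P \<epsilon>"
proof -
  have "\<forall>\<^sub>F \<epsilon> in at_right (0::real). 0 < \<epsilon> \<and> \<epsilon> \<le> 1 \<and> P \<epsilon>"
    using assms eventually_at_right_less[of 0]
      eventually_at_right_real[OF zero_less_one] by eventually_elim auto
  then show ?thesis using that eventually_happens trivial_limit_at_right_real by blast
qed

section \<open>Smallness of \<open>lam\<close> and the total mass\<close>

text \<open>This half uses only \<open>a >= 4 - \<epsilon>\<close> beyond the bubble radius, which
  bounds \<open>ln (1/r)\<close> by \<open>mu g' mu/(4 - \<epsilon>)\<close>. It must precede the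
  upper bound on the total mass, which relies on the smallness of \<open>g' mu lam\<close> deduced
  from it.\<close>

lemma ln_lam_lower:
  assumes "y < (2 - p) / 2"
  shows "\<forall>\<^sub>F n in sequentially. y < ln (1 / lam n) / g (mu n)"
proof -
  have "((\<lambda>\<epsilon>. 1 - 2 / (4 - \<epsilon>) * p) \<longlongrightarrow> 1 - 2 / (4 - 0) * p) (at_right 0)"
    by (intro tendsto_intros) auto
  from order_tendstoD(1)[OF this, of y] obtain \<epsilon> where
    \<epsilon>: "0 < \<epsilon>" "\<epsilon> \<le> 1" and y: "y < 1 - 2 / (4 - \<epsilon>) * p"
    using assms by (auto elim: small_parameter simp: diff_divide_distrib)
  \<comment> \<open>The bounded losses in \<open>ln_lam_eq\<close>: across the bubble in
    \<open>g\<close>, from \<open>h >= 1/C\<close>, and from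
    \<open>b <= 11 \<epsilon>\<close>.\<close>
  define k where "k = 16 / \<epsilon> + ln C + ln (11 * \<epsilon>)"
  have "((\<lambda>t. 1 - k / g t - 2 / (4 - \<epsilon>) * (t * g' t / g t)) \<longlongrightarrow> 1 - 0 - 2 / (4 - \<epsilon>) * p) at_top"
    by (intro tendsto_intros lim_const_over_g lim_p)
  then have "\<forall>\<^sub>F t in at_top. y < 1 - k / g t - 2 / (4 - \<epsilon>) * (t * g' t / g t)"
    by (rule order_tendstoD) (use y in simp)
  from along_mu[OF this] along_mu[OF g_pos_ev] bubble_radius_ev[OF \<epsilon> zero_less_one]
  show ?thesis
  proof eventually_elim
    case (elim n)
    then obtain r where br: "bubble_radius \<epsilon> n r" by blast
    note D = br[unfolded bubble_radius_def] and E = bubble_radiusD[OF br \<epsilon>]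
    interpret S: radial_solution g g' g'' t0 q p h h' f f' "u n" "u' n" "u'' n" C "lam n" "mu n"
      by (rule E)
    have "(4 - \<epsilon>) * ln (1 / r) \<le> g' (mu n) * u n r"
      using S.height_bounds(1)[of r "4 - \<epsilon>" "A n 1"] S.a_mono[of r] S.a_mono[of _ 1] D by auto
    also have "\<dots> \<le> g' (mu n) * mu n" using E D by (intro mult_left_mono) auto
    finally have ln_r: "2 * ln (1 / r) \<le> 2 / (4 - \<epsilon>) * (mu n * g' (mu n))"
      using \<epsilon> by (simp add: field_simps)
    have "1 / C \<le> h r" using S.h_lower[of r] D C_ge_1 by (simp add: field_simps)
    then have ln_h: "- ln C \<le> ln (h r)"
      using S.h_pos[of r] C_ge_1 D by (subst ln_inverse[symmetric]) (auto simp: inverse_eq_divide)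
    have ln_b: "ln (B n r) \<le> ln (11 * \<epsilon>)" using D \<epsilon> by auto
    have "0 \<le> ln (g' (mu n))" using D by simp
    then have "g (mu n) - k - 2 / (4 - \<epsilon>) * (mu n * g' (mu n)) \<le> ln (1 / lam n)"
      using S.ln_lam_eq[of r] D E(3) ln_r ln_h ln_b unfolding k_def by linarith
    then have "(g (mu n) - k - 2 / (4 - \<epsilon>) * (mu n * g' (mu n))) / g (mu n) \<le> ln (1 / lam n) / g (mu n)"
      using elim by (intro divide_right_mono) auto
    then show ?case using elim by (simp add: diff_divide_distrib)
  qed
qed

text \<open>As \<open>p < 2\<close>, the preceding bound makes \<open>lam\<close> exponentially
  small in \<open>g mu\<close>, while \<open>g' mu <= g mu\<close>. Here \<open>y\<close> is half
  the expected limit.\<close>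

lemma g'_lam_tendsto_0: "(\<lambda>n. g' (mu n) * lam n) \<longlonglongrightarrow> 0"
proof -
  define y where "y = (2 - p) / 4"
  have y: "0 < y" "y < (2 - p) / 2" using p_less_2 by (auto simp: y_def)
  have "((\<lambda>x::real. x * exp (- y * x)) \<longlongrightarrow> 0) at_top" using y by real_asymp
  then have "((\<lambda>t. g t * exp (- y * g t)) \<longlongrightarrow> 0) at_top"
    using g_at_top by (rule filterlim_compose)
  then have lim: "(\<lambda>n. g (mu n) * exp (- y * g (mu n))) \<longlonglongrightarrow> 0" by (rule lim_along_mu)
  show ?thesis
  proof (rule tendsto_sandwich[OF _ _ tendsto_const lim])
    show "\<forall>\<^sub>F n in sequentially. 0 \<le> g' (mu n) * lam n"
      using mu_gt_ev
      by eventually_elim (use g'_pos lam_pos in \<open>simp add: less_imp_le\<close>)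
    show "\<forall>\<^sub>F n in sequentially. g' (mu n) * lam n \<le> g (mu n) * exp (- y * g (mu n))"
      using ln_lam_lower[OF y(2)] along_mu[OF g'_le_g] along_mu[OF g_pos_ev]
    proof eventually_elim
      case (elim n)
      then have "ln (lam n) \<le> - y * g (mu n)"
        using lam_pos[of n] by (simp add: ln_div field_simps)
      then have "lam n \<le> exp (- y * g (mu n))" using lam_pos[of n] by (metis exp_le_cancel_iff exp_ln)
      then show ?case using elim lam_pos[of n] by (intro mult_mono) auto
    qed
  qed
qed

lemma lam_tendsto_0: "lam \<longlonglongrightarrow> 0"
proof (rule tendsto_sandwich[OF _ _ tendsto_const g'_lam_tendsto_0])
  have "\<forall>\<^sub>F t in at_top. 1 \<le> g' t" using g'_at_top by (simp add: filterlim_at_top)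
  from along_mu[OF this] show "\<forall>\<^sub>F n in sequentially. lam n \<le> g' (mu n) * lam n"
    by eventually_elim (use lam_pos in \<open>simp add: less_imp_le\<close>)
qed (use lam_pos in \<open>simp add: less_imp_le\<close>)

text \<open>\<open>tail_mass\<close> is applied at a bubble radius. Its chord condition holds
  because \<open>g mu\<close> is about \<open>mu g' mu/p\<close>, \<open>g (u r)\<close> differs
  from it by \<open>O(1)\<close>, and \<open>1/p > 1/2\<close>.\<close>

lemma total_mass_upper:
  assumes "0 < \<delta>"
  shows "\<forall>\<^sub>F n in sequentially. A n 1 \<le> 4 + \<delta>"
proof -
  \<comment> \<open>A quarter of the gap between \<open>1/p\<close> and \<open>1/2\<close>, leaving
    room for \<open>2/(4 - \<epsilon>)\<close> to exceed \<open>1/2\<close>. Only then is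
    \<open>\<epsilon>\<close> chosen, so that the tail term \<open>C^2 11 \<epsilon>/(3 c)\<close>
    is below \<open>\<delta>/2\<close>.\<close>
  define c where "c = (1 / p - 1 / 2) / 4"
  have c: "0 < c" using p_less_2 p_pos by (simp add: c_def field_simps)
  have "1 / 2 + c < 1 / p" using c by (simp add: c_def field_simps)
  have "((\<lambda>\<epsilon>. 2 / (4 - \<epsilon>) + c) \<longlongrightarrow> 2 / (4 - 0) + c) (at_right 0)"
    by (intro tendsto_intros) auto
  then have 1: "\<forall>\<^sub>F \<epsilon> in at_right 0. 2 / (4 - \<epsilon>) + c < 1 / p"
    by (rule order_tendstoD) (use \<open>1 / 2 + c < 1 / p\<close> in simp)
  have "((\<lambda>\<epsilon>. C\<^sup>2 * (11 * \<epsilon>) / (3 * c)) \<longlongrightarrow> C\<^sup>2 * (11 * 0) / (3 * c)) (at_right 0)"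
    using c by (intro tendsto_intros) auto
  then have 2: "\<forall>\<^sub>F \<epsilon> in at_right 0. C\<^sup>2 * (11 * \<epsilon>) / (3 * c) < \<delta> / 2"
    by (rule order_tendstoD) (use assms in simp)
  obtain \<epsilon> where \<epsilon>: "0 < \<epsilon>" "\<epsilon> \<le> 1" and \<epsilon>c: "2 / (4 - \<epsilon>) + c < 1 / p"
    and \<epsilon>\<delta>: "C\<^sup>2 * (11 * \<epsilon>) / (3 * c) < \<delta> / 2"
    using small_parameter[OF eventually_conj[OF 1 2]] by blast
  \<comment> \<open>Accounts for the loss of \<open>g\<close> across the bubble and for the left end
    \<open>g t0\<close> of the chord.\<close>
  define k where "k = 16 / \<epsilon> + g t0"
  define l where "l = 2 / (4 - \<epsilon>) + c"
  have l: "0 < l" "l * p < 1" using \<epsilon> \<epsilon>c c p_pos by (auto simp: l_def less_divide_eq add_pos_pos)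
  have "((\<lambda>t. l * (t * g' t / g t) + k / g t) \<longlongrightarrow> l * p + 0) at_top"
    by (intro tendsto_intros lim_const_over_g lim_p)
  then have *: "\<forall>\<^sub>F t in at_top. l * (t * g' t / g t) + k / g t < 1"
    by (rule order_tendstoD) (use l in simp)
  have "(\<lambda>n. g' (mu n) * lam n * C\<^sup>2) \<longlonglongrightarrow> 0 * C\<^sup>2"
    by (intro tendsto_intros g'_lam_tendsto_0)
  then have **: "\<forall>\<^sub>F n in sequentially. g' (mu n) * lam n * C\<^sup>2 < \<delta> / 2"
    by (rule order_tendstoD) (use assms in simp)
  show ?thesis
    using along_mu[OF *] ** along_mu[OF g_pos_ev] bubble_radius_ev[OF \<epsilon> zero_less_one]
  proof eventually_elim
    case (elim n)
    then obtain r where br: "bubble_radius \<epsilon> n r" by blast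
    note D = br[unfolded bubble_radius_def] and E = bubble_radiusD[OF br \<epsilon>]
    interpret S: radial_solution g g' g'' t0 q p h h' f f' "u n" "u' n" "u'' n" C "lam n" "mu n"
      by (rule E)
    have "l * g' (mu n) * (u n r - t0) \<le> l * g' (mu n) * mu n"
      using D E(2) l t0_nonneg by (intro mult_left_mono) auto
    also have "\<dots> \<le> g (mu n) - k" using elim by (simp add: field_simps)
    also have "\<dots> \<le> g (u n r) - g t0" using E(3) by (simp add: k_def)
    finally have "l * g' (mu n) * (u n r - t0) \<le> g (u n r) - g t0" .
    then have "A n 1 \<le> A n r + C\<^sup>2 * B n r / (3 * c) + g' (mu n) * lam n * C\<^sup>2"
      using D \<epsilon> c by (intro S.tail_mass) (auto simp: l_def)
    moreover have "C\<^sup>2 * B n r / (3 * c) \<le> C\<^sup>2 * (11 * \<epsilon>) / (3 * c)"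
      using D c by (intro divide_right_mono mult_left_mono) auto
    ultimately show ?case using D elim \<epsilon>\<delta> \<epsilon> by linarith
  qed
qed

text \<open>Monotonicity squeezes \<open>a\<close> on the interval from \<open>\<eta>\<close> to
  \<open>1\<close> between its value \<open>4 - \<epsilon>\<close> at a bubble radius below
  \<open>\<eta>\<close> and the total mass.\<close>

lemma mass_close:
  assumes "0 < \<delta>" "0 < \<eta>"
  shows "\<forall>\<^sub>F n in sequentially. \<forall>r\<in>{\<eta>..1}. \<bar>A n r - 4\<bar> \<le> \<delta>"
proof -
  define \<epsilon> where "\<epsilon> = min \<delta> 1"
  have \<epsilon>: "0 < \<epsilon>" "\<epsilon> \<le> 1" "\<epsilon> \<le> \<delta>" using assms by (auto simp: \<epsilon>_def)
  show ?thesis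
    using total_mass_upper[OF assms(1)] bubble_radius_ev[OF \<epsilon>(1,2) assms(2)]
  proof eventually_elim
    case (elim n)
    then obtain s where br: "bubble_radius \<epsilon> n s" "s < \<eta>" by blast
    note D = br(1)[unfolded bubble_radius_def]
    interpret S: radial_solution g g' g'' t0 q p h h' f f' "u n" "u' n" "u'' n" C "lam n" "mu n"
      by (rule bubble_radiusD[OF br(1) \<epsilon>(1,2)])
    show ?case
    proof
      fix r assume r: "r \<in> {\<eta>..1}"
      have "A n s \<le> A n r" "A n r \<le> A n 1" using S.a_mono[of s r] S.a_mono[of r 1] D br r by auto
      then show "\<bar>A n r - 4\<bar> \<le> \<delta>" using D elim \<epsilon> by (simp add: abs_le_iff)
    qed
  qed
qed

section \<open>The limits of the integrals and of \<open>ln (1 / lam)\<close>\<close>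

lemma A_1_tendsto: "(\<lambda>n. A n 1) \<longlonglongrightarrow> 4"
proof (rule tendstoI)
  fix e :: real assume e: "0 < e"
  have "\<forall>\<^sub>F n in sequentially. \<forall>r\<in>{1/2..1}. \<bar>A n r - 4\<bar> \<le> e / 2"
    by (rule mass_close) (use e in auto)
  then show "\<forall>\<^sub>F n in sequentially. dist (A n 1) 4 < e"
    by eventually_elim (use e in \<open>auto simp: dist_real_def dest: bspec[of _ _ 1]\<close>)
qed

lemma mass_tendsto:
  "(\<lambda>n. g' (mu n) * integral {0..1} (\<lambda>r. lam n * h r * f (u n r) * r)) \<longlonglongrightarrow> 4"
proof (rule Lim_transform_eventually[OF A_1_tendsto])
  show "\<forall>\<^sub>F n in sequentially.
      A n 1 = g' (mu n) * integral {0..1} (\<lambda>r. lam n * h r * f (u n r) * r)"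
    using mu_gt_ev
  proof eventually_elim
    case (elim n)
    interpret S: radial_solution g g' g'' t0 q p h h' f f' "u n" "u' n" "u'' n" C "lam n" "mu n"
      by (rule sol[OF elim])
    show ?case using S.mass_eq by simp
  qed
qed

text \<open>From below the mass inside a bubble radius is used, where
  \<open>g'(u) >= (1 - \<epsilon>) g' mu\<close>; from above the total mass. The errors
  \<open>lam C^2\<close> vanish.\<close>

lemma f'_mass_tendsto:
  "(\<lambda>n. integral {0..1} (\<lambda>r. lam n * h r * f' (u n r) * r)) \<longlonglongrightarrow> 4"
proof (rule order_tendstoI)
  fix y :: real assume y: "y < 4"
  have "((\<lambda>\<epsilon>. (1 - \<epsilon>) * (4 - \<epsilon>)) \<longlongrightarrow> (1 - 0) * (4 - 0)) (at_right (0::real))"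
    by (intro tendsto_intros)
  from order_tendstoD(1)[OF this, of y] obtain \<epsilon> where
    \<epsilon>: "0 < \<epsilon>" "\<epsilon> \<le> 1" and y\<epsilon>: "y < (1 - \<epsilon>) * (4 - \<epsilon>)"
    using y by (auto elim: small_parameter)
  have "(\<lambda>n. (1 - \<epsilon>) * (4 - \<epsilon>) - lam n * C\<^sup>2) \<longlonglongrightarrow> (1 - \<epsilon>) * (4 - \<epsilon>) - 0 * C\<^sup>2"
    by (intro tendsto_intros lam_tendsto_0)
  then have "\<forall>\<^sub>F n in sequentially. y < (1 - \<epsilon>) * (4 - \<epsilon>) - lam n * C\<^sup>2"
    by (rule order_tendstoD) (use y\<epsilon> in simp)
  then show "\<forall>\<^sub>F n in sequentially. y < integral {0..1} (\<lambda>r. lam n * h r * f' (u n r) * r)"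
    using bubble_radius_ev[OF \<epsilon> zero_less_one]
  proof eventually_elim
    case (elim n)
    then obtain r where br: "bubble_radius \<epsilon> n r" by blast
    note D = br[unfolded bubble_radius_def]
    interpret S: radial_solution g g' g'' t0 q p h h' f f' "u n" "u' n" "u'' n" C "lam n" "mu n"
      by (rule bubble_radiusD[OF br \<epsilon>])
    show ?case using S.f'_mass_lower[of r "1 - \<epsilon>"] D elim by auto
  qed
next
  fix y :: real assume y: "4 < y"
  have "(\<lambda>n. A n 1 + lam n * C\<^sup>2) \<longlonglongrightarrow> 4 + 0 * C\<^sup>2"
    by (intro tendsto_intros lam_tendsto_0 A_1_tendsto)
  then have "\<forall>\<^sub>F n in sequentially. A n 1 + lam n * C\<^sup>2 < y"
    by (rule order_tendstoD) (use y in simp)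
  then show "\<forall>\<^sub>F n in sequentially. integral {0..1} (\<lambda>r. lam n * h r * f' (u n r) * r) < y"
    using mu_gt_ev
  proof eventually_elim
    case (elim n)
    interpret S: radial_solution g g' g'' t0 q p h h' f f' "u n" "u' n" "u'' n" C "lam n" "mu n"
      by (rule sol[OF elim(2)])
    show ?case using S.f'_mass_upper elim by simp
  qed
qed

text \<open>With total mass at most \<open>4 + \<delta>\<close>, the height at the bubble radius
  forces \<open>ln (1/r)\<close> to be at least about \<open>mu g' mu/(4 + \<delta>)\<close>. The
  bubble radius for \<open>\<epsilon> = 1\<close> suffices, since that parameter enters bounded
  terms only.\<close>

lemma ln_lam_upper:
  assumes "(2 - p) / 2 < y"
  shows "\<forall>\<^sub>F n in sequentially. ln (1 / lam n) / g (mu n) < y"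
proof -
  have "((\<lambda>\<delta>. 1 - 2 / (4 + \<delta>) * p) \<longlongrightarrow> 1 - 2 / (4 + 0) * p) (at_right 0)"
    by (intro tendsto_intros) auto
  from order_tendstoD(2)[OF this, of y] obtain \<delta> where
    \<delta>: "0 < \<delta>" "\<delta> \<le> 1" and y: "1 - 2 / (4 + \<delta>) * p < y"
    using assms by (auto elim: small_parameter simp: diff_divide_distrib)
  \<comment> \<open>At \<open>\<epsilon> = 1\<close> the drop bound \<open>16/\<epsilon>\<close> is
    \<open>16\<close> and the lower bound \<open>\<epsilon>/2\<close> of \<open>b\<close> is
    \<open>1/2\<close>.\<close>
  define k where "k = ln C + 2 / (4 + \<delta>) * 16 - ln (1 / 2)"
  have "((\<lambda>t. 1 + k / g t - 2 / (4 + \<delta>) * (t * g' t / g t) + ln (g' t) / g t)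
      \<longlongrightarrow> 1 + 0 - 2 / (4 + \<delta>) * p + 0) at_top"
    by (intro tendsto_intros lim_const_over_g lim_p lim_ln_g')
  then have "\<forall>\<^sub>F t in at_top. 1 + k / g t - 2 / (4 + \<delta>) * (t * g' t / g t) + ln (g' t) / g t < y"
    by (rule order_tendstoD) (use y in simp)
  from along_mu[OF this] along_mu[OF g_pos_ev] bubble_radius_ev[OF zero_less_one order_refl zero_less_one]
    total_mass_upper[OF \<delta>(1)]
  show ?thesis
  proof eventually_elim
    case (elim n)
    then obtain r where br: "bubble_radius 1 n r" by blast
    note D = br[unfolded bubble_radius_def] and E = bubble_radiusD[OF br zero_less_one order_refl]
    interpret S: radial_solution g g' g'' t0 q p h h' f f' "u n" "u' n" "u'' n" C "lam n" "mu n"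
      by (rule E)
    have "g' (mu n) * mu n - 16 \<le> g' (mu n) * u n r" using D by (simp add: right_diff_distrib)
    also have "\<dots> \<le> A n 1 * ln (1 / r)"
      using S.height_bounds(2)[of r 0 "A n 1"] S.a_nonneg S.a_mono[of _ 1] D by auto
    also have "\<dots> \<le> (4 + \<delta>) * ln (1 / r)"
      using elim D by (intro mult_right_mono) (auto simp: ln_div)
    finally have "2 / (4 + \<delta>) * (g' (mu n) * mu n - 16) \<le> 2 / (4 + \<delta>) * ((4 + \<delta>) * ln (1 / r))"
      using \<delta> by (intro mult_left_mono) auto
    then have ln_r: "2 / (4 + \<delta>) * (mu n * g' (mu n)) - 2 / (4 + \<delta>) * 16 \<le> 2 * ln (1 / r)"
      using \<delta> by (simp add: right_diff_distrib mult.commute)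
    have ln_h: "ln (h r) \<le> ln C" using S.h_upper[of r] S.h_pos[of r] D by simp
    have ln_b: "ln (1 / 2) \<le> ln (B n r)" using D by (subst ln_le_cancel_iff) auto
    have "ln (1 / lam n) \<le> g (mu n) + k - 2 / (4 + \<delta>) * (mu n * g' (mu n)) + ln (g' (mu n))"
      using S.ln_lam_eq[of r] D E(4) ln_r ln_h ln_b unfolding k_def by linarith
    then have "ln (1 / lam n) / g (mu n)
        \<le> (g (mu n) + k - 2 / (4 + \<delta>) * (mu n * g' (mu n)) + ln (g' (mu n))) / g (mu n)"
      using elim by (intro divide_right_mono) auto
    then show ?case using elim by (simp add: diff_divide_distrib add_divide_distrib)
  qed
qed

lemma ln_lam_tendsto: "(\<lambda>n. ln (1 / lam n) / g (mu n)) \<longlonglongrightarrow> (2 - p) / 2"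
  by (rule order_tendstoI) (use ln_lam_lower ln_lam_upper in auto)

section \<open>Local convergence with two derivatives\<close>

text \<open>Keeps \<open>f(u)\<close> bounded away from the origin, as the estimate of
  \<open>u''\<close> requires: \<open>g' mu u\<close> is at most \<open>5 ln (1/\<eta>)\<close>
  there, while \<open>g' mu\<close> tends to infinity.\<close>

lemma u_le_1_ev:
  assumes \<eta>: "0 < \<eta>" "\<eta> < 1"
  shows "\<forall>\<^sub>F n in sequentially. \<forall>r\<in>{\<eta>..1}. u n r \<le> 1"
proof -
  have "\<forall>\<^sub>F t in at_top. 5 * ln (1 / \<eta>) \<le> g' t" using g'_at_top by (simp add: filterlim_at_top)
  from along_mu[OF this] mu_gt_ev mass_close[OF zero_less_one \<eta>(1)] show ?thesis
  proof eventually_elim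
    case (elim n)
    interpret S: radial_solution g g' g'' t0 q p h h' f f' "u n" "u' n" "u'' n" C "lam n" "mu n"
      by (rule sol[OF elim(2)])
    have "3 \<le> A n s \<and> A n s \<le> 5" if "\<eta> < s" "s < 1" for s
      using elim(3) that by (auto simp: abs_le_iff dest!: bspec[of _ _ s])
    then have "g' (mu n) * u n \<eta> \<le> 5 * ln (1 / \<eta>)" using S.height_bounds(2)[OF \<eta>, of 3 5] by blast
    also have "\<dots> \<le> g' (mu n) * 1" using elim by simp
    finally have "u n \<eta> \<le> 1" using S.G_pos by simp
    then show ?case using S.u_antimono[of \<eta>] \<eta> by fastforce
  qed
qed

lemma C2_convergence:
  assumes \<eta>: "0 < \<eta>" "\<eta> < 1" and F: "\<And>t. 0 \<le> t \<Longrightarrow> t \<le> 1 \<Longrightarrow> f t \<le> F"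
  shows "uniform_limit {\<eta>..1} (\<lambda>n r. g' (mu n) * u n r) (\<lambda>r. 4 * ln (1 / r)) sequentially"
    and "uniform_limit {\<eta>..1} (\<lambda>n r. g' (mu n) * u' n r) (\<lambda>r. - 4 / r) sequentially"
    and "uniform_limit {\<eta>..1} (\<lambda>n r. g' (mu n) * u'' n r) (\<lambda>r. 4 / r\<^sup>2) sequentially"
proof -
  have est: "\<forall>\<^sub>F n in sequentially. \<forall>r\<in>{\<eta>..1}.
      \<bar>g' (mu n) * u n r - 4 * ln (1 / r)\<bar> < e \<and>
      \<bar>g' (mu n) * u' n r - (- 4 / r)\<bar> < e \<and>
      \<bar>g' (mu n) * u'' n r - 4 / r\<^sup>2\<bar> < e" if e: "0 < e" for e
  proof -
    have lims: "((\<lambda>\<delta>. \<delta> * ln (1 / \<eta>)) \<longlongrightarrow> 0 * ln (1 / \<eta>)) (at_right 0)"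
      "((\<lambda>\<delta>. \<delta> / \<eta>) \<longlongrightarrow> 0 / \<eta>) (at_right 0)"
      "((\<lambda>\<delta>. \<delta> / \<eta>\<^sup>2) \<longlongrightarrow> 0 / \<eta>\<^sup>2) (at_right 0)"
      using \<eta> by (intro tendsto_intros; simp)+
    \<comment> \<open>The second derivative gets only \<open>e/2\<close>; the other half is left for
      the source term \<open>g' mu lam C F\<close>.\<close>
    have "\<forall>\<^sub>F \<delta> in at_right 0. \<delta> * ln (1 / \<eta>) < e \<and> \<delta> / \<eta> < e \<and> \<delta> / \<eta>\<^sup>2 < e / 2"
      by (intro eventually_conj order_tendstoD(2)[OF lims(1)] order_tendstoD(2)[OF lims(2)]
          order_tendstoD(2)[OF lims(3)]) (use e in simp_all)
    then obtain \<delta> where \<delta>: "0 < \<delta>" "\<delta> * ln (1 / \<eta>) < e" "\<delta> / \<eta> < e" "\<delta> / \<eta>\<^sup>2 < e / 2"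
      by (elim small_parameter) blast
    have "(\<lambda>n. g' (mu n) * lam n * C * F) \<longlonglongrightarrow> 0 * C * F"
      by (intro tendsto_intros g'_lam_tendsto_0)
    then have "\<forall>\<^sub>F n in sequentially. g' (mu n) * lam n * C * F < e / 2"
      by (rule order_tendstoD) (use e in simp)
    then show ?thesis using mass_close[OF \<delta>(1) \<eta>(1)] u_le_1_ev[OF \<eta>] mu_gt_ev
    proof eventually_elim
      case (elim n)
      interpret S: radial_solution g g' g'' t0 q p h h' f f' "u n" "u' n" "u'' n" C "lam n" "mu n"
        by (rule sol[OF elim(4)])
      show ?case
      proof
        fix r assume r: "r \<in> {\<eta>..1}"
        have fF: "f (u n r) \<le> F" using F[of "u n r"] S.u_nonneg[of r] elim(3) r \<eta> by simp
        note cl = S.C2_close[OF \<eta> r elim(2)]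
        show "\<bar>g' (mu n) * u n r - 4 * ln (1 / r)\<bar> < e \<and>
          \<bar>g' (mu n) * u' n r - (- 4 / r)\<bar> < e \<and>
          \<bar>g' (mu n) * u'' n r - 4 / r\<^sup>2\<bar> < e"
          using cl(1) cl(2) cl(3)[OF fF] \<delta> elim(1) by linarith
      qed
    qed
  qed
  show "uniform_limit {\<eta>..1} (\<lambda>n r. g' (mu n) * u n r) (\<lambda>r. 4 * ln (1 / r)) sequentially"
    and "uniform_limit {\<eta>..1} (\<lambda>n r. g' (mu n) * u' n r) (\<lambda>r. - 4 / r) sequentially"
    and "uniform_limit {\<eta>..1} (\<lambda>n r. g' (mu n) * u'' n r) (\<lambda>r. 4 / r\<^sup>2) sequentially"
    by (rule uniform_limitI, use est in \<open>force simp: dist_real_def elim!: eventually_mono\<close>)+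
qed

end

text \<open>Since \<open>q > 2\<close> rules out \<open>q = 1\<close>, \<open>H1\<close> forces
  \<open>p\<close> to be finite, so it is taken real. Convergence in C^2_loc((0,1]) is expressed as
  uniform convergence of the functions and their first two derivatives on compact subsets.\<close>

theorem theoremA1:
  fixes h h' f f' f'' g g' g'' :: "real \<Rightarrow> real"
    and t0 q p :: real
    and lam mu :: "nat \<Rightarrow> real"
    and u u' u'' :: "nat \<Rightarrow> real \<Rightarrow> real"
  assumes h_C1: "\<And>r. r \<in> {0..1} \<Longrightarrow> (h has_real_derivative h' r) (at r within {0..1})"
      and h'_cont: "continuous_on {0..1} h'"
      and h_pos: "\<And>r. r \<in> {0..1} \<Longrightarrow> h r > 0"
      and f_C1: "\<And>t. t \<ge> 0 \<Longrightarrow> (f has_real_derivative f' t) (at t within {0..})"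
      and f'_cont: "continuous_on {0..} f'"
      and f_nonneg: "\<And>t. t \<ge> 0 \<Longrightarrow> f t \<ge> 0"
      and t0: "t0 \<ge> 0"
      and f_pos: "\<And>t. t \<ge> t0 \<Longrightarrow> f t > 0"
      and f_C2: "\<And>t. t \<ge> t0 \<Longrightarrow> (f' has_real_derivative f'' t) (at t within {t0..})"
      and f''_cont: "continuous_on {t0..} f''"
      and g_def: "\<And>t. t \<ge> t0 \<Longrightarrow> g t = ln (f t)"
      and g_d1: "\<And>t. t \<ge> t0 \<Longrightarrow> (g has_real_derivative g' t) (at t within {t0..})"
      and g_d2: "\<And>t. t \<ge> t0 \<Longrightarrow> (g' has_real_derivative g'' t) (at t within {t0..})"
      and H1: "H1 f g g' g'' t0 q (ereal p)"
      and q_gt: "q > 2"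
      and lam_pos: "\<And>n. lam n > 0"
      and mu_pos: "\<And>n. mu n > 0"
      and u_d1: "\<And>n r. r \<in> {0..1} \<Longrightarrow> (u n has_real_derivative u' n r) (at r within {0..1})"
      and u_d2: "\<And>n r. r \<in> {0..1} \<Longrightarrow> (u' n has_real_derivative u'' n r) (at r within {0..1})"
      and u''_cont: "\<And>n. continuous_on {0..1} (u'' n)"
      and u_eq: "\<And>n r. r \<in> {0<..<1} \<Longrightarrow>
                   - u'' n r - u' n r / r = lam n * h r * f (u n r)"
      and u_pos: "\<And>n r. r \<in> {0<..<1} \<Longrightarrow> u n r > 0"
      and u_0: "\<And>n. u n 0 = mu n"
      and u'_0: "\<And>n. u' n 0 = 0"
      and u_1: "\<And>n. u n 1 = 0"
      and mu_lim: "filterlim mu at_top sequentially"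
  shows "((\<lambda>n. g' (mu n) * integral {0..1} (\<lambda>r. lam n * h r * f (u n r) * r)) \<longlonglongrightarrow> 4)
       \<and> ((\<lambda>n. integral {0..1} (\<lambda>r. lam n * h r * f' (u n r) * r)) \<longlonglongrightarrow> 4)
       \<and> (\<forall>K. compact K \<and> K \<subseteq> {0<..1} \<longrightarrow>
           uniform_limit K (\<lambda>n r. g' (mu n) * u n r) (\<lambda>r. 4 * ln (1 / r)) sequentially \<and>
           uniform_limit K (\<lambda>n r. g' (mu n) * u' n r) (\<lambda>r. - 4 / r) sequentially \<and>
           uniform_limit K (\<lambda>n r. g' (mu n) * u'' n r) (\<lambda>r. 4 / r\<^sup>2) sequentially)
       \<and> ((\<lambda>n. ln (1 / lam n) / g (mu n)) \<longlonglongrightarrow> (2 - p) / 2)"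
proof -
  have f_exp: "f t = exp (g t)" if "t0 \<le> t" for t
    using g_def[OF that] f_pos[OF that] by simp
  have f'_exp: "f' t = g' t * f t" if t: "t0 \<le> t" for t
  \<comment> \<open>At \<open>t0\<close> the derivative of \<open>g\<close> is one-sided, so both
    derivatives of \<open>f\<close> are compared within \<open>{t0..}\<close>.\<close>
  proof (rule has_field_derivative_unique)
    show "(f has_real_derivative f' t) (at t within {t0..})"
      by (rule DERIV_subset[OF f_C1]) (use t t0 in auto)
    have "((\<lambda>s. exp (g s)) has_real_derivative g' t * f t) (at t within {t0..})"
      using g_d1[OF t] by (auto intro!: derivative_eq_intros simp: f_exp[OF t])
    then show "(f has_real_derivative g' t * f t) (at t within {t0..})"
      by (rule has_field_derivative_transform_within[where d = 1]) (use t f_exp in auto)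
    show "at t within {t0..} \<noteq> bot"
      using not_trivial_limit_within[of t "{t0..}"] t
      by (metis at_within_Ici_at_right at_within_interior greaterThan_iff interior_real_atLeast
          order_le_less trivial_limit_at_right_real at_neq_bot)
  qed
  have h_cont: "continuous_on {0..1} h"
    by (rule DERIV_continuous_on, erule h_C1)
  have f_cont: "continuous_on {0..} f"
    by (rule DERIV_continuous_on[OF f_C1]) simp
  have bounded: "\<exists>M. \<forall>x\<in>{0..c}. \<bar>F x\<bar> \<le> M" if "continuous_on {0..c} F" for c :: real and F :: "real \<Rightarrow> real"
    using compact_imp_bounded[OF compact_continuous_image[OF that compact_Icc]]
    by (auto simp: bounded_iff)
  have Icc_sub: "{0..c} \<subseteq> {0..}" for c :: real by auto
  have inv_h_cont: "continuous_on {0..1} (\<lambda>r. 1 / h r)" "continuous_on {0..1} (\<lambda>r. h' r / h r)"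
    using h_pos by (auto intro!: continuous_intros h_cont h'_cont simp: less_imp_neq[symmetric])
  obtain M1 where M1: "\<And>r. r \<in> {0..1} \<Longrightarrow> \<bar>h r\<bar> \<le> M1" using bounded[OF h_cont] by blast
  obtain M2 where M2: "\<And>r. r \<in> {0..1} \<Longrightarrow> \<bar>1 / h r\<bar> \<le> M2" using bounded[OF inv_h_cont(1)] by blast
  obtain M3 where M3: "\<And>r. r \<in> {0..1} \<Longrightarrow> \<bar>h' r / h r\<bar> \<le> M3" using bounded[OF inv_h_cont(2)] by blast
  obtain M4 where M4: "\<And>t. t \<in> {0..t0} \<Longrightarrow> \<bar>f t\<bar> \<le> M4"
    using bounded[OF continuous_on_subset[OF f_cont Icc_sub]] by blast
  obtain M5 where M5: "\<And>t. t \<in> {0..t0} \<Longrightarrow> \<bar>f' t\<bar> \<le> M5"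
    using bounded[OF continuous_on_subset[OF f'_cont Icc_sub]] by blast
  \<comment> \<open>The bound is taken on \<open>[0,1]\<close> because, away from the origin, the
    solutions eventually have values there.\<close>
  obtain F where F: "\<And>t. t \<in> {0..1} \<Longrightarrow> \<bar>f t\<bar> \<le> F"
    using bounded[OF continuous_on_subset[OF f_cont Icc_sub]] by blast
  define C where "C = Max {1, M1, M2, M3, M4, M5}"
  have C: "1 \<le> C" "M1 \<le> C" "M2 \<le> C" "M3 \<le> C" "M4 \<le> C" "M5 \<le> C"
    by (simp_all add: C_def)
  interpret subquadratic_growth g g' g'' t0 q p
    using H1 g_d1 g_d2 q_gt t0 unfolding H1_def by unfold_locales auto
  interpret blowup_sequence g g' g'' t0 q p h h' f f' u u' u'' C lam mu
  proof (intro blowup_sequence.intro blowup_sequence_axioms.intro subquadratic_growth_axioms)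
    fix n assume mu: "t0 < mu n"
    have "\<bar>h' r\<bar> \<le> C * h r \<and> h r \<le> C \<and> 1 \<le> C * h r" if r: "r \<in> {0..1}" for r
    proof -
      have hp: "0 < h r" by (rule h_pos[OF r])
      have "\<bar>h' r\<bar> / h r \<le> C" "1 / h r \<le> C" "h r \<le> C"
        using M1[OF r] M2[OF r] M3[OF r] C hp by auto
      then show ?thesis using hp by (simp add: divide_le_eq)
    qed
    moreover have "f t \<le> C \<and> \<bar>f' t\<bar> \<le> C" if "0 \<le> t" "t \<le> t0" for t
      using M4[of t] M5[of t] C that by auto
    moreover have "0 \<le> u n r" if "r \<in> {0..1}" for r
      using u_pos[of r n] u_0[of n] u_1[of n] mu_pos[of n] that
      by (cases "r = 0"; cases "r = 1") (auto intro: less_imp_le)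
    ultimately show "radial_solution g g' g'' t0 q p h h' f f' (u n) (u' n) (u'' n) C (lam n) (mu n)"
      using h_C1 f_C1 f'_cont f_nonneg f_exp f'_exp lam_pos u_d1 u_d2 u''_cont u_eq u_0 u_1 mu C(1)
      by unfold_locales auto
  next
    have "filterlim (\<lambda>t. exp (g t)) at_top at_top"
      by (rule filterlim_compose[OF exp_at_top g_at_top])
    then show "filterlim f at_top at_top"
      by (rule filterlim_mono_eventually)
        (auto intro: eventually_mono[OF eventually_ge_at_top[of t0]] simp: f_exp)
  qed (use mu_lim C lam_pos in auto)
  have "uniform_limit K (\<lambda>n r. g' (mu n) * u n r) (\<lambda>r. 4 * ln (1 / r)) sequentially \<and>
      uniform_limit K (\<lambda>n r. g' (mu n) * u' n r) (\<lambda>r. - 4 / r) sequentially \<and>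
      uniform_limit K (\<lambda>n r. g' (mu n) * u'' n r) (\<lambda>r. 4 / r\<^sup>2) sequentially"
    if K: "compact K" "K \<subseteq> {0<..1}" for K
  proof -
    \<comment> \<open>A nonempty compact subset of \<open>(0,1]\<close> has a positive minimum;
      capping by \<open>1/2\<close> keeps \<open>\<eta> < 1\<close>.\<close>
    obtain \<eta> where \<eta>: "0 < \<eta>" "\<eta> < 1" "K \<subseteq> {\<eta>..1}"
    proof (cases "K = {}")
      case True
      then show ?thesis using that[of "1 / 2"] by simp
    next
      case False
      then obtain m where m: "m \<in> K" "\<And>x. x \<in> K \<Longrightarrow> m \<le> x"
        using compact_attains_inf[OF K(1)] by blast
      show ?thesis
        by (rule that[of "min m (1 / 2)"]) (use m K(2) in \<open>auto simp: min_le_iff_disj\<close>)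
    qed
    have "f t \<le> F" if "0 \<le> t" "t \<le> 1" for t using F[of t] that by simp
    from C2_convergence[OF \<eta>(1,2) this] show ?thesis
      using uniform_limit_on_subset[OF _ \<eta>(3)] by blast
  qed
  then show ?thesis using mass_tendsto f'_mass_tendsto ln_lam_tendsto by blast
qed

end
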